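(* Let $\mu\in\mathbb{R}^n$, $\sigma^2>0$, $Y\sim\mathcal{N}(\mu,\sigma^2I)$ on $\mathbb{R}^n$, and let $X$ be an arbitrary $n\times p$ real matrix. For $\lambda>0$ let $\hat\mu^\lambda_{\textnormal{l-OLS}}$ denote the lasso-OLS estimator with design matrix $X$ and tuning parameter $\lambda$. Then, for every $\lambda>0$, $$\mathrm{df}(\hat\mu^\lambda_{\textnormal{l-OLS}})=\mathrm{df}_{\mathrm{S}}(\hat\mu^\lambda_{\textnormal{l-OLS}})-\lambda\,\partial_\lambda\mathrm{df}_{\mathrm{S}}(\hat\mu^\lambda_{\textnormal{l-OLS}}),$$ where $\partial_\lambda$ denotes differentiation with respect to $\lambda$.
   Context: For a measurable $\hat\mu:\mathbb{R}^n\to\mathbb{R}^n$ (defined Lebesgue a.e.) with $\hat\mu(Y)$ of finite second moment, the degrees of freedom is $$\mathrm{df}(\hat\mu)=\sum_{i=1}^n\frac{\mathrm{cov}(Y_i,\hat\mu(Y)_i)}{\sigma^2}.$$ If $\hat\mu$ is differentiable at Lebesgue almost all points and $\mathrm{div}(\hat\mu)(Y)$ has finite first moment, where $\mathrm{div}(f)=\sum_{i=1}^n\partial_i f_i$, Stein's degrees of freedom is $\mathrm{df}_{\mathrm{S}}(\hat\mu)=E(\mathrm{div}(\hat\mu)(Y))$. Lasso-OLS estimator. For $A\subseteq\{1,\dots,p\}$, $X_A$ is the matrix whose columns are those of $X$ indexed by $A$, and $\mathrm{col}(X_A)$ is its column space. Let $\mathcal{S}=\{\mathrm{col}(X_A)\mid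 A\subseteq\{1,\dots,p\}\}$, and for $S\in\mathcal{S}$ let $\Pi_S$ be the orthogonal projection of $\mathbb{R}^n$ onto $S$. For $y\in\mathbb{R}^n$ and $\lambda>0$, a lasso solution is any $$\hat\beta^\lambda\in\arg\min_{\beta\in\mathbb{R}^p}\ \tfrac12\|y-X\beta\|_2^2+\lambda\|\beta\|_1,$$ and its support $\mathrm{supp}(\hat\beta^\lambda)\subseteq\{1,\dots,p\}$ is called an active set. It is known (Tibshirani and Taylor, 2012) that, for each $\lambda>0$, there is a Lebesgue null set $N\subseteq\mathbb{R}^n$ such that for $y\notin N$ the space $\mathrm{col}(X_A)$ with $A=\mathrm{supp}(\hat\beta^\lambda)$ is the same for all lasso solutions $\hat\beta^\lambda$ at $y$; denote this space by $\widehat{S}^\lambda(y)\in\mathcal{S}$. The lasso-OLS estimator is $\hat\mu^\lambda_{\textnormal{l-OLS}}(y)=\Pi_{\widehat{S}^\lambda(y)}\,y$ for $y\notin N$; it is thus defined Lebesgue almost everywhere. *)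

theory Defs
  imports "HOL-Probability.Probability"
begin

section \<open>Degrees of freedom\<close>

definition gaussian_density :: "real ^ 'n \<Rightarrow> real \<Rightarrow> real ^ 'n \<Rightarrow> real" where
  "gaussian_density \<mu> \<sigma> y = (\<Prod>i\<in>UNIV. normal_density (\<mu> $ i) \<sigma> (y $ i))"

definition covariance :: "'w measure \<Rightarrow> ('w \<Rightarrow> real) \<Rightarrow> ('w \<Rightarrow> real) \<Rightarrow> real" where
  "covariance M U V =
     (\<integral>\<omega>. (U \<omega> - (\<integral>\<omega>'. U \<omega>' \<partial>M)) * (V \<omega> - (\<integral>\<omega>'. V \<omega>' \<partial>M)) \<partial>M)"

text \<open>
  Estimators and their derivatives matter only up to Lebesgue null sets, so for them measurability
  is Lebesgue measurability, and expectations are taken over the completion of the underlying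
  probability space. For random variables measurable with respect to \<open>M\<close> itself, the completion
  gives the same expectations (\<open>integral_completion\<close>).

  The predicates \<open>df_exists\<close> and \<open>stein_df_exists\<close> are the conditions under which \<open>df\<close> and
  \<open>stein_df\<close> are meaningful; outside of them the latter are arbitrary values.
\<close>

definition df_exists ::
    "'w measure \<Rightarrow> ('w \<Rightarrow> real ^ 'n) \<Rightarrow> (real ^ 'n \<Rightarrow> real ^ 'n) \<Rightarrow> bool" where
  "df_exists M Y f \<longleftrightarrow>
     f \<in> borel_measurable lebesgue \<and> integrable (completion M) (\<lambda>\<omega>. (norm (f (Y \<omega>)))\<^sup>2)"

definition df ::
    "'w measure \<Rightarrow> ('w \<Rightarrow> real ^ 'n) \<Rightarrow> real \<Rightarrow> (real ^ 'n \<Rightarrow> real ^ 'n) \<Rightarrow> real" where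
  "df M Y \<sigma> f =
     (\<Sum>i\<in>UNIV. covariance (completion M) (\<lambda>\<omega>. Y \<omega> $ i) (\<lambda>\<omega>. f (Y \<omega>) $ i) / \<sigma>\<^sup>2)"

definition divergence :: "(real ^ 'n \<Rightarrow> real ^ 'n) \<Rightarrow> real ^ 'n \<Rightarrow> real" where
  "divergence f y = (\<Sum>i\<in>UNIV. frechet_derivative f (at y) (axis i 1) $ i)"

definition stein_df_exists ::
    "'w measure \<Rightarrow> ('w \<Rightarrow> real ^ 'n) \<Rightarrow> (real ^ 'n \<Rightarrow> real ^ 'n) \<Rightarrow> bool" where
  "stein_df_exists M Y f \<longleftrightarrow>
     f \<in> borel_measurable lebesgue \<and>
     (AE y in lebesgue. f differentiable (at y)) \<and>
     integrable (completion M) (\<lambda>\<omega>. divergence f (Y \<omega>))"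

definition stein_df ::
    "'w measure \<Rightarrow> ('w \<Rightarrow> real ^ 'n) \<Rightarrow> (real ^ 'n \<Rightarrow> real ^ 'n) \<Rightarrow> real" where
  "stein_df M Y f = (\<integral>\<omega>. divergence f (Y \<omega>) \<partial>completion M)"


section \<open>The lasso-OLS estimator\<close>

definition lasso_objective ::
    "real ^ 'p ^ 'n \<Rightarrow> real \<Rightarrow> real ^ 'n \<Rightarrow> real ^ 'p \<Rightarrow> real" where
  "lasso_objective X l y \<beta> = 1 / 2 * (norm (y - X *v \<beta>))\<^sup>2 + l * (\<Sum>j\<in>UNIV. \<bar>\<beta> $ j\<bar>)"

definition lasso_solution ::
    "real ^ 'p ^ 'n \<Rightarrow> real \<Rightarrow> real ^ 'n \<Rightarrow> real ^ 'p \<Rightarrow> bool" where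
  "lasso_solution X l y \<beta> \<longleftrightarrow> is_arg_min (lasso_objective X l y) (\<lambda>_. True) \<beta>"

definition supp :: "real ^ 'p \<Rightarrow> 'p set" where
  "supp \<beta> = {j. \<beta> $ j \<noteq> 0}"

definition col_space :: "real ^ 'p ^ 'n \<Rightarrow> 'p set \<Rightarrow> (real ^ 'n) set" where
  "col_space X A = span ((\<lambda>j. column j X) ` A)"

definition orth_proj :: "(real ^ 'n) set \<Rightarrow> real ^ 'n \<Rightarrow> real ^ 'n" where
  "orth_proj S y = (THE z. z \<in> S \<and> (\<forall>w\<in>S. orthogonal (y - z) w))"

definition lasso_spaces ::
    "real ^ 'p ^ 'n \<Rightarrow> real \<Rightarrow> real ^ 'n \<Rightarrow> (real ^ 'n) set set" where
  "lasso_spaces X l y = {col_space X (supp \<beta>) | \<beta>. lasso_solution X l y \<beta>}"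

text \<open>
  For almost every \<open>y\<close> all lasso solutions have the same active column space, that is,
  \<open>lasso_spaces X l y\<close> is a singleton. The estimator is defined for these \<open>y\<close> only; the value 0
  on the remaining null set is a totalization.
\<close>

definition lasso_ols :: "real ^ 'p ^ 'n \<Rightarrow> real \<Rightarrow> real ^ 'n \<Rightarrow> real ^ 'n" where
  "lasso_ols X l y =
     (if is_singleton (lasso_spaces X l y) then orth_proj (the_elem (lasso_spaces X l y)) y else 0)"

end

theory Submission
  imports Defs
begin

text \<open>
  The lasso objective is homogeneous under \<open>(\<lambda>, y, \<beta>) \<mapsto> (t \<lambda>, t y, t \<beta>)\<close>, so both the lasso fit
  \<open>g\<^sub>t\<close> and the lasso-OLS estimator \<open>f\<^sub>t\<close> are \<open>y \<mapsto> t h(y / t)\<close> for their version \<open>h\<close> at parameter 1.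
  The fit is nonexpansive, and outside a closed null set it is locally \<open>\<Pi>\<^sub>S y - t c\<close> with
  \<open>S\<close> and \<open>c\<close> locally constant, whereas \<open>f\<^sub>t y = \<Pi>\<^sub>S y\<close>. Hence the two have the same divergence,
  and Stein's identity for the Lipschitz map \<open>g\<^sub>t\<close> gives \<open>df\<^sub>S(f\<^sub>t) = E[(Y - \<mu>) \<bullet> g\<^sub>t(Y)] / \<sigma>\<^sup>2\<close>.
  Differentiating this under the integral and using \<open>f\<^sub>t = g\<^sub>t - t \<partial>\<^sub>t g\<^sub>t\<close> almost everywhere yields
  the claim, because \<open>df(f\<^sub>t) = E[(Y - \<mu>) \<bullet> f\<^sub>t(Y)] / \<sigma>\<^sup>2\<close>.
\<close>


section \<open>Gaussian integrals and Stein's identity\<close>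

text \<open>They are what the correction term measures. Nor can \<open>stein_df\<close> be
  differentiated in the parameter under the expectation as it stands: the divergence is the
  dimension of the active space, an integer that is locally constant off a null set, so its
  pointwise derivative vanishes and the whole change comes from moving jumps. Passing to the fit
  before applying Stein's identity removes both obstacles. The fit has no jumps in \<open>y\<close>,
  and for fixed \<open>y\<close> its difference quotients in the parameter are bounded by a linear
  function of the norm of \<open>y\<close>, which dominated convergence can use. The local formula
  in \<open>y\<close> also yields the one in \<open>t\<close>, because changing \<open>t\<close> at
  fixed \<open>y\<close> moves only the point \<open>y / t\<close> at which the version for
  parameter 1 is evaluated.\<close>

lemma gaussian_density_eq:
  fixes \<mu> y :: "real ^ 'n"
  shows "gaussian_density \<mu> \<sigma> y =
    (1 / sqrt (2 * pi * \<sigma>\<^sup>2)) ^ CARD('n) * exp (- (norm (y - \<mu>))\<^sup>2 / (2 * \<sigma>\<^sup>2))"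
proof -
  have "gaussian_density \<mu> \<sigma> y =
      (\<Prod>i\<in>(UNIV::'n set). 1 / sqrt (2 * pi * \<sigma>\<^sup>2)) * exp (\<Sum>i\<in>UNIV. - (y $ i - \<mu> $ i)\<^sup>2 / (2 * \<sigma>\<^sup>2))"
    unfolding gaussian_density_def normal_density_def prod.distrib by (simp add: exp_sum)
  moreover have "(\<Sum>i\<in>UNIV. - (y $ i - \<mu> $ i)\<^sup>2 / (2 * \<sigma>\<^sup>2)) = - (norm (y - \<mu>))\<^sup>2 / (2 * \<sigma>\<^sup>2)"
    by (simp add: norm_vec_def L2_set_def sum_nonneg sum_negf flip: sum_divide_distrib)
  ultimately show ?thesis by simp
qed

lemma gaussian_density_pos: "\<sigma> > 0 \<Longrightarrow> gaussian_density \<mu> \<sigma> y > 0"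
  by (simp add: gaussian_density_eq)

lemma gaussian_density_nonneg [simp]: "gaussian_density \<mu> \<sigma> y \<ge> 0"
  by (simp add: gaussian_density_def prod_nonneg)

lemma continuous_gaussian_density: "continuous_on S (gaussian_density \<mu> \<sigma>)"
  unfolding gaussian_density_eq[abs_def] by (cases "\<sigma> = 0") (auto intro!: continuous_intros)

lemma borel_measurable_gaussian_density [measurable]: "gaussian_density \<mu> \<sigma> \<in> borel_measurable borel"
  by (intro borel_measurable_continuous_onI continuous_gaussian_density)

lemma lebesgue_measurable_gaussian_density: "gaussian_density \<mu> \<sigma> \<in> borel_measurable lebesgue"
  by (intro measurable_completion) simp

lemma gaussian_density_integrable:
  fixes \<mu> :: "real ^ 'n"
  assumes "\<sigma> > 0"
  shows "integrable lebesgue (gaussian_density \<mu> \<sigma>)"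
proof -
  let ?f = "\<lambda>b::real^'n. normal_density (\<mu> \<bullet> b) \<sigma>"
  have inj: "inj (\<lambda>i::'n. axis i (1::real))" by (auto simp: inj_def axis_eq_axis)
  have bas: "(Basis::(real^'n) set) = range (\<lambda>i. axis i 1)"
    by (auto simp: Basis_vec_def)
  have eq: "ennreal (gaussian_density \<mu> \<sigma> y) = (\<Prod>b\<in>Basis. ennreal (?f b (y \<bullet> b)))" for y
    unfolding bas gaussian_density_def using inj
    by (simp add: prod.reindex inner_axis prod_ennreal)
  have "(\<integral>\<^sup>+y. ennreal (gaussian_density \<mu> \<sigma> y) \<partial>lborel)
      = (\<Prod>b\<in>Basis. (\<integral>\<^sup>+x. ennreal (?f b x) \<partial>lborel))"
    unfolding eq by (intro nn_integral_lborel_prod) auto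
  also have "\<dots> < \<infinity>"
    using integrable_normal_density[OF assms]
    by (subst nn_integral_eq_integral) (auto simp: prod_ennreal)
  finally have "integrable lborel (gaussian_density \<mu> \<sigma>)"
    using assms by (intro integrableI_nonneg) (auto intro!: less_imp_le gaussian_density_pos)
  then show ?thesis by (simp add: integrable_completion)
qed

text \<open>The Gaussian with doubled standard deviation dominates: the quadratic left over in the
  exponent absorbs any linear term \<open>b * r\<close>.\<close>

lemma exp_growth_gaussian_integrable:
  fixes \<mu> :: "real ^ 'n"
  assumes s: "\<sigma> > 0" and w: "w \<in> borel_measurable lebesgue"
    and bd: "AE y in lebesgue. \<bar>w y\<bar> \<le> C * exp (b * norm (y - \<mu>))"
  shows "integrable lebesgue (\<lambda>y. gaussian_density \<mu> \<sigma> y * w y)"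
proof -
  define K where "K = (1 / sqrt (2 * pi * \<sigma>\<^sup>2)) ^ CARD('n)"
  define K' where "K' = (1 / sqrt (2 * pi * (2*\<sigma>)\<^sup>2)) ^ CARD('n)"
  \<comment> \<open>Not the optimal constant, but one for which the slack in \<open>main\<close> is
    visibly a sum of squares. The 3/8 occurring there is 1/2 - 1/8, the gap between the exponents
    for \<open>\<sigma>\<close> and \<open>2 * \<sigma>\<close>.\<close>
  define c where "c = 2 * b\<^sup>2 * \<sigma>\<^sup>2"
  have K: "K > 0" "K' > 0" using s by (auto simp: K_def K'_def)
  have main: "b * r - r\<^sup>2 / (2*\<sigma>\<^sup>2) \<le> c - r\<^sup>2 / (2*(2*\<sigma>)\<^sup>2)" for r
  proof -
    have "0 \<le> (r / (2 * \<sigma>) - 2 * b * \<sigma> / 2) ^2 + r\<^sup>2 / (8*\<sigma>\<^sup>2) + b\<^sup>2 * \<sigma>\<^sup>2" by simp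
    also have "\<dots> = c - b * r + 3 / 8 * (r\<^sup>2 / \<sigma>\<^sup>2)"
      using s by (simp add: c_def power2_diff power_mult_distrib power_divide power2_eq_square[of \<sigma>] field_simps)
    finally show ?thesis by (simp add: power_mult_distrib)
  qed
  have C: "gaussian_density \<mu> \<sigma> y * exp (b * norm (y - \<mu>)) \<le> K / K' * exp c * gaussian_density \<mu> (2*\<sigma>) y" for y
  proof -
    have "exp (b * norm (y-\<mu>) - (norm (y-\<mu>))\<^sup>2 / (2*\<sigma>\<^sup>2)) \<le> exp (c - (norm (y-\<mu>))\<^sup>2 / (2*(2*\<sigma>)\<^sup>2))"
      using main by simp
    then show ?thesis using K
      unfolding gaussian_density_eq K_def[symmetric] K'_def[symmetric]
      by (simp add: exp_diff exp_minus field_simps)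
  qed
  have 1: "AE y in lebesgue. norm (gaussian_density \<mu> \<sigma> y * w y) \<le> norm (\<bar>C\<bar> * (K / K' * exp c) * gaussian_density \<mu> (2*\<sigma>) y)"
    using bd
  proof eventually_elim
    case (elim y)
    have "\<bar>gaussian_density \<mu> \<sigma> y * w y\<bar> \<le> gaussian_density \<mu> \<sigma> y * (C * exp (b * norm (y - \<mu>)))"
      using elim gaussian_density_pos[OF s, of \<mu> y] by (simp add: abs_mult)
    also have "\<dots> \<le> \<bar>C\<bar> * (gaussian_density \<mu> \<sigma> y * exp (b * norm (y - \<mu>)))"
      using gaussian_density_pos[OF s, of \<mu> y] mult_right_mono[of C "\<bar>C\<bar>" "gaussian_density \<mu> \<sigma> y * exp (b * norm (y - \<mu>))"]
      by (simp add: mult_ac)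
    also have "\<dots> \<le> \<bar>C\<bar> * (K / K' * exp c * gaussian_density \<mu> (2*\<sigma>) y)"
      using C by (intro mult_left_mono) auto
    finally have "\<bar>gaussian_density \<mu> \<sigma> y * w y\<bar> \<le> \<bar>C\<bar> * (K / K' * exp c) * gaussian_density \<mu> (2*\<sigma>) y"
      by (simp only: mult.assoc)
    also note abs_ge_self
    finally show ?case by (simp only: real_norm_def)
  qed
  have 2: "integrable lebesgue (\<lambda>y. \<bar>C\<bar> * (K / K' * exp c) * gaussian_density \<mu> (2*\<sigma>) y)"
    using s by (intro integrable_mult_right gaussian_density_integrable) simp
  show ?thesis
    by (rule Bochner_Integration.integrable_bound[OF 2 _ 1]) (intro borel_measurable_times lebesgue_measurable_gaussian_density w)
qed

text \<open>The Cameron-Martin factor of a shift. Its derivative at \<open>h = 0\<close> is the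
  score \<open>(y $ i - \<mu> $ i) / \<sigma>\<^sup>2\<close>, which is how that weight enters
  Stein's identity.\<close>

lemma gaussian_density_shift:
  fixes \<mu> :: "real ^ 'n"
  assumes s: "\<sigma> > 0"
  shows "gaussian_density \<mu> \<sigma> (y - h *\<^sub>R axis i 1)
    = gaussian_density \<mu> \<sigma> y * exp ((h * (y $ i - \<mu> $ i) - h\<^sup>2 / 2) / \<sigma>\<^sup>2)"
proof -
  have "(norm (y - h *\<^sub>R axis i 1 - \<mu>))\<^sup>2 = (norm ((y - \<mu>) - h *\<^sub>R axis i 1))\<^sup>2" by (simp add: algebra_simps)
  also have "\<dots> = (norm (y - \<mu>))\<^sup>2 - 2 * h * (y $ i - \<mu> $ i) + h\<^sup>2"
    unfolding power2_norm_eq_inner by (simp add: inner_diff inner_axis inner_axis' power2_eq_square algebra_simps)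
  finally have eq: "(norm (y - h *\<^sub>R axis i 1 - \<mu>))\<^sup>2
      = (norm (y - \<mu>))\<^sup>2 - 2 * h * (y $ i - \<mu> $ i) + h\<^sup>2" .
  have "- (norm (y - h *\<^sub>R axis i 1 - \<mu>))\<^sup>2 / (2 * \<sigma>\<^sup>2)
      = - (norm (y - \<mu>))\<^sup>2 / (2 * \<sigma>\<^sup>2) + (h * (y $ i - \<mu> $ i) - h\<^sup>2 / 2) / \<sigma>\<^sup>2"
    unfolding eq by (simp add: diff_divide_distrib add_divide_distrib)
  then show ?thesis unfolding gaussian_density_eq by (simp only: exp_add mult.assoc)
qed

text \<open>The factor linear in \<open>z\<close> cancels the denominator of a difference quotient,
  which leaves a bound uniform in the step size. Both signs follow from
  \<open>1 + x \<le> exp x\<close>.\<close>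

lemma abs_exp_minus_one_le: "\<bar>exp z - 1\<bar> \<le> \<bar>z\<bar> * exp \<bar>z\<bar>" for z :: real
proof (cases "z \<ge> 0")
  case True
  have "1 - z \<le> exp (- z)" using exp_ge_add_one_self[of "-z"] by simp
  then have "(1 - z) * exp z \<le> exp (-z) * exp z" by (rule mult_right_mono) simp
  then show ?thesis using True by (simp add: exp_minus algebra_simps)
next
  case False
  have "1 - exp z \<le> -z" using exp_ge_add_one_self[of z] by linarith
  also have "\<dots> \<le> - z * exp (- z)" using False mult_left_mono[of 1 "exp (-z)" "-z"] by simp
  finally show ?thesis using False by simp
qed

lemma lebesgue_integral_translate:
  fixes g :: "'a::euclidean_space \<Rightarrow> real"
  assumes "g \<in> borel_measurable borel"
  shows "(\<integral>y. g (y + a) \<partial>lebesgue) = (\<integral>y. g y \<partial>lebesgue)"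
proof -
  have "(\<integral>y. g y \<partial>lborel) = (\<integral>y. g y \<partial>distr lborel borel ((+) a))" by (simp add: lborel_distr_plus)
  also have "\<dots> = (\<integral>y. g (a + y) \<partial>lborel)" using assms by (intro integral_distr) auto
  finally show ?thesis using assms by (simp add: integral_completion add.commute)
qed

text \<open>
  Translating the difference quotients of \<open>g\<close> onto the density turns the limit of one side into the
  derivative of \<open>g\<close> and the limit of the other one into the derivative of the density.
\<close>

lemma stein_identity:
  fixes g D :: "real ^ 'n \<Rightarrow> real"
  assumes s: "\<sigma> > 0" and lip: "L-lipschitz_on UNIV g"
    and D: "D \<in> borel_measurable lebesgue"
    and deriv: "AE y in lebesgue. ((\<lambda>h. g (y + h *\<^sub>R axis i 1)) has_real_derivative D y) (at 0)"
  shows "integrable lebesgue (\<lambda>y. gaussian_density \<mu> \<sigma> y * D y)"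
    and "(\<integral>y. gaussian_density \<mu> \<sigma> y * ((y $ i - \<mu> $ i) * g y) \<partial>lebesgue)
      = \<sigma>\<^sup>2 * (\<integral>y. gaussian_density \<mu> \<sigma> y * D y \<partial>lebesgue)"
proof -
  let ?\<phi> = "gaussian_density \<mu> \<sigma>"
  define h :: "nat \<Rightarrow> real" where "h k = 1 / real (Suc k)" for k
  have h: "h k > 0" "h k \<le> 1" for k by (auto simp: h_def)
  have h0: "h \<longlonglongrightarrow> 0" unfolding h_def by real_asymp
  have hat: "filterlim h (at 0) sequentially"
    using h0 h(1) by (auto simp: filterlim_at less_imp_neq[symmetric])
  have L: "L \<ge> 0" using lip by (rule lipschitz_on_nonneg)
  have gb [measurable]: "g \<in> borel_measurable borel"
    by (intro borel_measurable_continuous_onI lipschitz_on_continuous_on[OF lip])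
  define Q where "Q k y = (g (y + h k *\<^sub>R axis i 1) - g y) / h k" for k y
  have Qb: "\<bar>Q k y\<bar> \<le> L" for k y
    using lipschitz_onD[OF lip, of "y + h k *\<^sub>R axis i 1" y] h[of k]
    by (auto simp: Q_def dist_norm divide_simps)
  have Qm [measurable]: "Q k \<in> borel_measurable borel" for k unfolding Q_def by measurable
  have Qlim: "AE y in lebesgue. (\<lambda>k. ?\<phi> y * Q k y) \<longlonglongrightarrow> ?\<phi> y * D y"
    using deriv
  proof eventually_elim
    case (elim y)
    then have "((\<lambda>h. (g (y + h *\<^sub>R axis i 1) - g y) / h) \<longlongrightarrow> D y) (at 0)"
      by (simp add: has_field_derivative_iff)
    from filterlim_compose[OF this hat] show ?case
      unfolding Q_def by (intro tendsto_mult_left) simp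
  qed
  have m1: "(\<lambda>y. ?\<phi> y * D y) \<in> borel_measurable lebesgue" "\<And>k. (\<lambda>y. ?\<phi> y * Q k y) \<in> borel_measurable lebesgue"
    by (intro borel_measurable_times lebesgue_measurable_gaussian_density D measurable_completion; simp)+
  have i1: "integrable lebesgue (\<lambda>y. ?\<phi> y * L)"
    by (intro integrable_mult_left gaussian_density_integrable s)
  have b1: "AE y in lebesgue. norm (?\<phi> y * Q k y) \<le> ?\<phi> y * L" for k
    using Qb by (intro AE_I2) (auto simp: abs_mult intro!: mult_left_mono)
  show "integrable lebesgue (\<lambda>y. ?\<phi> y * D y)"
    by (rule integrable_dominated_convergence[OF m1 i1 Qlim b1])
  have lim1: "(\<lambda>k. \<integral>y. ?\<phi> y * Q k y \<partial>lebesgue) \<longlonglongrightarrow> (\<integral>y. ?\<phi> y * D y \<partial>lebesgue)"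
    by (rule integral_dominated_convergence[OF m1 i1 Qlim b1])
  \<comment> \<open>By \<open>gaussian_density_shift\<close>, the density times \<open>R k\<close>
    is \<open>g\<close> times the difference quotient of the density under the shift of its argument
    by \<open>- h k\<close> along axis \<open>i\<close>. Keeping the density as a factor makes the
    growth lemma applicable.\<close>
  define R where "R k y = g y * ((exp ((h k * (y $ i - \<mu> $ i) - (h k)\<^sup>2 / 2) / \<sigma>\<^sup>2) - 1) / h k)" for k y
  have gexp: "\<bar>g y\<bar> \<le> (\<bar>g \<mu>\<bar> + L) * exp (norm (y - \<mu>))" for y
  proof -
    have "\<bar>g y\<bar> \<le> \<bar>g \<mu>\<bar> + L * norm (y - \<mu>)"
      using lipschitz_onD[OF lip, of y \<mu>] by (auto simp: dist_norm)
    also have "\<dots> \<le> \<bar>g \<mu>\<bar> * exp (norm (y - \<mu>)) + L * exp (norm (y - \<mu>))"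
    proof (intro add_mono mult_left_mono L)
      show "norm (y - \<mu>) \<le> exp (norm (y - \<mu>))"
        using exp_ge_add_one_self[of "norm (y - \<mu>)"] by linarith
    qed (simp add: mult_le_cancel_left1)
    finally show ?thesis by (simp add: algebra_simps)
  qed
  have gint: "integrable lebesgue (\<lambda>y. ?\<phi> y * g y)"
    by (rule exp_growth_gaussian_integrable[OF s, where b=1 and C="\<bar>g \<mu>\<bar> + L"])
      (use gexp in \<open>auto intro: measurable_completion\<close>)
  have Rm [measurable]: "R k \<in> borel_measurable borel" for k unfolding R_def by measurable
  \<comment> \<open>With \<open>r\<close> the distance to \<open>\<mu>\<close>, one
    \<open>exp r\<close> comes from the growth of \<open>g\<close>, a second one from
    \<open>r + 1 \<le> exp r\<close>, and \<open>exp ((r + 1) / \<sigma>\<^sup>2)\<close> from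
    \<open>abs_exp_minus_one_le\<close>, where \<open>h k \<le> 1\<close> is used.\<close>
  have Rb: "\<bar>R k y\<bar> \<le> (\<bar>g \<mu>\<bar> + L) * exp (1 / \<sigma>\<^sup>2) / \<sigma>\<^sup>2 * exp ((2 + 1 / \<sigma>\<^sup>2) * norm (y - \<mu>))" for k y
  proof -
    define r where "r = norm (y - \<mu>)"
    define z where "z = (h k * (y $ i - \<mu> $ i) - (h k)\<^sup>2 / 2) / \<sigma>\<^sup>2"
    have r: "r \<ge> 0" "\<bar>y $ i - \<mu> $ i\<bar> \<le> r"
      using component_le_norm_cart[of "y - \<mu>" i] by (auto simp: r_def)
    have "\<bar>z\<bar> = \<bar>h k * ((y $ i - \<mu> $ i) - h k / 2)\<bar> / \<sigma>\<^sup>2"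
      by (simp add: z_def power2_eq_square algebra_simps)
    also have "\<dots> \<le> h k * (r + 1) / \<sigma>\<^sup>2"
      using r h[of k] unfolding abs_mult by (intro divide_right_mono mult_mono) auto
    finally have z: "\<bar>z\<bar> \<le> h k * ((r + 1) / \<sigma>\<^sup>2)" by simp
    also have "\<dots> \<le> 1 * ((r + 1) / \<sigma>\<^sup>2)"
      using r h[of k] by (intro mult_right_mono) auto
    finally have z': "\<bar>z\<bar> \<le> (r + 1) / \<sigma>\<^sup>2" by simp
    have "\<bar>exp z - 1\<bar> \<le> (h k * ((r + 1) / \<sigma>\<^sup>2)) * exp ((r + 1) / \<sigma>\<^sup>2)"
      using z z' r h[of k] by (intro order_trans[OF abs_exp_minus_one_le] mult_mono) auto
    then have "\<bar>(exp z - 1) / h k\<bar> \<le> ((r + 1) / \<sigma>\<^sup>2) * exp ((r + 1) / \<sigma>\<^sup>2)"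
      using h[of k] by (simp add: divide_le_eq mult_ac)
    also have "\<dots> \<le> (exp r / \<sigma>\<^sup>2) * exp ((r + 1) / \<sigma>\<^sup>2)"
      using exp_ge_add_one_self[of r] by (intro mult_right_mono divide_right_mono) (auto simp: add.commute)
    finally have "\<bar>(exp z - 1) / h k\<bar> \<le> (exp r / \<sigma>\<^sup>2) * exp ((r + 1) / \<sigma>\<^sup>2)" .
    then have "\<bar>R k y\<bar> \<le> ((\<bar>g \<mu>\<bar> + L) * exp r) * ((exp r / \<sigma>\<^sup>2) * exp ((r + 1) / \<sigma>\<^sup>2))"
      using gexp[of y] L unfolding R_def z_def[symmetric] r_def[symmetric] abs_mult[of "g y"]
      by (intro mult_mono) auto
    also have "\<dots> = (\<bar>g \<mu>\<bar> + L) / \<sigma>\<^sup>2 * exp (r + r + (r + 1) / \<sigma>\<^sup>2)"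
      by (simp only: exp_add times_divide_eq_left times_divide_eq_right mult.assoc)
    also have "r + r + (r + 1) / \<sigma>\<^sup>2 = 1 / \<sigma>\<^sup>2 + (2 + 1 / \<sigma>\<^sup>2) * r"
      by (simp add: algebra_simps add_divide_distrib)
    also have "(\<bar>g \<mu>\<bar> + L) / \<sigma>\<^sup>2 * exp (1 / \<sigma>\<^sup>2 + (2 + 1 / \<sigma>\<^sup>2) * r)
        = (\<bar>g \<mu>\<bar> + L) * exp (1 / \<sigma>\<^sup>2) / \<sigma>\<^sup>2 * exp ((2 + 1 / \<sigma>\<^sup>2) * r)"
      by (simp only: exp_add times_divide_eq_left times_divide_eq_right mult.assoc)
    finally show ?thesis by (simp add: r_def)
  qed
  have Rint: "integrable lebesgue (\<lambda>y. ?\<phi> y * R k y)" for k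
    by (rule exp_growth_gaussian_integrable[OF s _ AE_I2[OF Rb]]) (simp add: measurable_completion)
  \<comment> \<open>Translation invariance moves the shift from \<open>g\<close> to the density.
    Both expansions contain the term \<open>?\<phi> y * g y\<close>, whose integral is finite by
    \<open>gint\<close> and cancels.\<close>
  have QR: "(\<integral>y. ?\<phi> y * Q k y \<partial>lebesgue) = (\<integral>y. ?\<phi> y * R k y \<partial>lebesgue)" for k
  proof -
    let ?a = "h k *\<^sub>R axis i (1::real)"
    have hk: "h k \<noteq> 0" using h(1)[of k] by simp
    have e1: "?\<phi> y * g (y + ?a) = ?\<phi> y * g y + h k * (?\<phi> y * Q k y)" for y
    proof -
      have "h k * Q k y = g (y + ?a) - g y" using hk by (simp add: Q_def)
      then have "g (y + ?a) = g y + h k * Q k y" by simp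
      then show ?thesis by (simp only: distrib_left mult.left_commute)
    qed
    have e2: "?\<phi> (y - ?a) * g y = ?\<phi> y * g y + h k * (?\<phi> y * R k y)" for y
    proof -
      let ?E = "exp ((h k * (y $ i - \<mu> $ i) - (h k)\<^sup>2 / 2) / \<sigma>\<^sup>2)"
      have "h k * R k y = g y * (?E - 1)" using hk by (simp add: R_def)
      then have "?E * g y = g y + h k * R k y" by (simp add: algebra_simps)
      then show ?thesis
        unfolding gaussian_density_shift[OF s] by (simp only: mult.assoc distrib_left mult.left_commute[of "h k"])
    qed
    have iQ: "integrable lebesgue (\<lambda>y. ?\<phi> y * Q k y)"
      by (rule integrable_dominated_convergence2[OF m1 i1 Qlim b1])
    have "(\<integral>y. ?\<phi> y * g (y + ?a) \<partial>lebesgue) = (\<integral>y. ?\<phi> (y - ?a) * g y \<partial>lebesgue)"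
      using lebesgue_integral_translate[of "\<lambda>y. ?\<phi> (y - ?a) * g y" ?a] by simp
    then show ?thesis unfolding e1 e2 using gint iQ Rint[of k] hk by simp
  qed
  have Rlim: "(\<lambda>k. ?\<phi> y * R k y) \<longlonglongrightarrow> ?\<phi> y * (g y * ((y $ i - \<mu> $ i) / \<sigma>\<^sup>2))" for y
  proof -
    have "((\<lambda>h. exp ((h * x - h\<^sup>2 / 2) * c)) has_real_derivative x * c) (at 0)" for x c :: real
      by (auto intro!: derivative_eq_intros)
    from this[of "y $ i - \<mu> $ i" "1 / \<sigma>\<^sup>2"]
    have "((\<lambda>h. exp ((h * (y $ i - \<mu> $ i) - h\<^sup>2 / 2) / \<sigma>\<^sup>2)) has_real_derivative (y $ i - \<mu> $ i) / \<sigma>\<^sup>2) (at 0)"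
      by simp
    then have "((\<lambda>h. (exp ((h * (y $ i - \<mu> $ i) - h\<^sup>2 / 2) / \<sigma>\<^sup>2) - 1) / h) \<longlongrightarrow> (y $ i - \<mu> $ i) / \<sigma>\<^sup>2) (at 0)"
      by (simp add: has_field_derivative_iff)
    from filterlim_compose[OF this hat] show ?thesis
      unfolding R_def by (intro tendsto_mult_left)
  qed
  have lim2: "(\<lambda>k. \<integral>y. ?\<phi> y * R k y \<partial>lebesgue) \<longlonglongrightarrow> (\<integral>y. ?\<phi> y * (g y * ((y $ i - \<mu> $ i) / \<sigma>\<^sup>2)) \<partial>lebesgue)"
  proof (rule integral_dominated_convergence)
    show "integrable lebesgue (\<lambda>y. ?\<phi> y * ((\<bar>g \<mu>\<bar> + L) * exp (1 / \<sigma>\<^sup>2) / \<sigma>\<^sup>2 * exp ((2 + 1 / \<sigma>\<^sup>2) * norm (y - \<mu>))))"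
      by (rule exp_growth_gaussian_integrable[OF s, where b="2 + 1 / \<sigma>\<^sup>2" and C="(\<bar>g \<mu>\<bar> + L) * exp (1 / \<sigma>\<^sup>2) / \<sigma>\<^sup>2"])
        (use L in \<open>auto intro!: measurable_completion\<close>)
    show "AE y in lebesgue. norm (?\<phi> y * R k y)
        \<le> ?\<phi> y * ((\<bar>g \<mu>\<bar> + L) * exp (1 / \<sigma>\<^sup>2) / \<sigma>\<^sup>2 * exp ((2 + 1 / \<sigma>\<^sup>2) * norm (y - \<mu>)))" for k
      unfolding real_norm_def abs_mult abs_of_nonneg[OF gaussian_density_nonneg]
      by (intro AE_I2 mult_left_mono Rb gaussian_density_nonneg)
  qed (use Rlim in \<open>auto intro!: measurable_completion\<close>)
  have "(\<integral>y. ?\<phi> y * (g y * ((y $ i - \<mu> $ i) / \<sigma>\<^sup>2)) \<partial>lebesgue) = (\<integral>y. ?\<phi> y * D y \<partial>lebesgue)"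
    using lim1 lim2 unfolding QR by (rule LIMSEQ_unique[rotated])
  moreover have "(\<integral>y. ?\<phi> y * ((y $ i - \<mu> $ i) * g y) \<partial>lebesgue)
      = (\<integral>y. \<sigma>\<^sup>2 * (?\<phi> y * (g y * ((y $ i - \<mu> $ i) / \<sigma>\<^sup>2))) \<partial>lebesgue)"
    using s by (intro Bochner_Integration.integral_cong) auto
  ultimately show "(\<integral>y. ?\<phi> y * ((y $ i - \<mu> $ i) * g y) \<partial>lebesgue) = \<sigma>\<^sup>2 * (\<integral>y. ?\<phi> y * D y \<partial>lebesgue)"
    by (simp only: integral_mult_right_zero)
qed

text \<open>Measurability with respect to Lebesgue sets requires that preimages of Lebesgue null
  sets be null. As the density is strictly positive, the law of \<open>Y\<close> and Lebesgue
  measure have the same null sets; for the same reason completion commutes with taking the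
  density.\<close>

lemma gaussian_transport:
  fixes Y :: "'w \<Rightarrow> real ^ 'n"
  assumes s: "\<sigma> > 0" and Y: "distributed M lborel Y (\<lambda>y. ennreal (gaussian_density \<mu> \<sigma> y))"
  shows "Y \<in> completion M \<rightarrow>\<^sub>M lebesgue"
    and "distr (completion M) lebesgue Y = density lebesgue (\<lambda>y. ennreal (gaussian_density \<mu> \<sigma> y))"
proof -
  let ?d = "\<lambda>y. ennreal (gaussian_density \<mu> \<sigma> y)"
  have Ym: "Y \<in> M \<rightarrow>\<^sub>M lborel" using Y by (simp add: distributed_def)
  have d: "distr (completion M) lborel Y = density lborel ?d"
    using Y Ym by (simp add: distr_completion distributed_def)
  have pos: "?d y > 0" for y using gaussian_density_pos[OF s] by simp
  have null: "null_sets (distr (completion M) lborel Y) = null_sets lborel"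
    unfolding d using pos
    by (auto simp: null_sets_density_iff set_eq_iff less_imp_neq[symmetric] AE_iff_null_sets[symmetric] dest: AE_not_in)
  show "Y \<in> completion M \<rightarrow>\<^sub>M lebesgue"
    by (rule completion.measurable_completion2) (use Ym null in \<open>auto intro: measurable_completion\<close>)
  have "distr (completion M) lebesgue Y = completion (density lborel ?d)"
    unfolding d[symmetric] using completion.completion_distr_eq[OF measurable_completion[OF Ym] null] by simp
  also have "\<dots> = density lebesgue ?d"
    using pos by (intro completion_density_eq) auto
  finally show "distr (completion M) lebesgue Y = density lebesgue ?d" .
qed

lemma
  fixes Y :: "'w \<Rightarrow> real ^ 'n" and w :: "real ^ 'n \<Rightarrow> real"
  assumes s: "\<sigma> > 0" and Y: "distributed M lborel Y (\<lambda>y. ennreal (gaussian_density \<mu> \<sigma> y))"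
    and w: "w \<in> borel_measurable lebesgue"
  shows integrable_gaussian: "integrable (completion M) (\<lambda>\<omega>. w (Y \<omega>)) \<longleftrightarrow>
      integrable lebesgue (\<lambda>y. gaussian_density \<mu> \<sigma> y * w y)"
    and integral_gaussian: "(\<integral>\<omega>. w (Y \<omega>) \<partial>completion M) = (\<integral>y. gaussian_density \<mu> \<sigma> y * w y \<partial>lebesgue)"
proof -
  note t = gaussian_transport[OF s Y]
  show "integrable (completion M) (\<lambda>\<omega>. w (Y \<omega>)) \<longleftrightarrow> integrable lebesgue (\<lambda>y. gaussian_density \<mu> \<sigma> y * w y)"
    unfolding integrable_distr_eq[OF t(1) w, symmetric] t(2) 
    using w by (subst integrable_density) (auto intro: measurable_completion)
  show "(\<integral>\<omega>. w (Y \<omega>) \<partial>completion M) = (\<integral>y. gaussian_density \<mu> \<sigma> y * w y \<partial>lebesgue)"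
    unfolding integral_distr[OF t(1) w, symmetric] t(2) 
    using w by (subst integral_density) (auto intro: measurable_completion)
qed

lemma quadratic_growth_gaussian_integrable:
  fixes \<mu> :: "real ^ 'n"
  assumes s: "\<sigma> > 0" and w: "w \<in> borel_measurable lebesgue"
    and bd: "AE y in lebesgue. \<bar>w y\<bar> \<le> C * (1 + norm (y - \<mu>))\<^sup>2"
  shows "integrable lebesgue (\<lambda>y. gaussian_density \<mu> \<sigma> y * w y)"
proof (rule exp_growth_gaussian_integrable[OF s w])
  show "AE y in lebesgue. \<bar>w y\<bar> \<le> \<bar>C\<bar> * exp (2 * norm (y - \<mu>))"
    using bd
  proof eventually_elim
    case (elim y)
    let ?r = "1 + norm (y - \<mu>)"
    have "C * ?r\<^sup>2 \<le> \<bar>C\<bar> * ?r\<^sup>2" by (intro mult_right_mono) auto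
    moreover have "?r\<^sup>2 \<le> (exp (norm (y - \<mu>)))\<^sup>2" by (intro power_mono) auto
    then have "\<bar>C\<bar> * ?r\<^sup>2 \<le> \<bar>C\<bar> * exp (2 * norm (y - \<mu>))"
      unfolding exp_double by (intro mult_left_mono) auto
    ultimately show ?case using elim by linarith
  qed
qed

text \<open>Completeness makes the values on the null set irrelevant. This supplies measurability
  for the discontinuous estimator and for its partial derivatives.\<close>

lemma lebesgue_measurable_if_isCont:
  fixes h :: "'a::euclidean_space \<Rightarrow> 'b::euclidean_space"
  assumes "closed N" "negligible N" and cont: "\<And>y. y \<notin> N \<Longrightarrow> isCont h y"
  shows "h \<in> borel_measurable lebesgue"
proof -
  have "h \<in> borel_measurable (lebesgue_on (UNIV - N))"
    using assms by (intro continuous_imp_measurable_on_sets_lebesgue)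
      (auto intro!: continuous_at_imp_continuous_on sets.Diff dest: negligible_imp_sets)
  then show ?thesis using assms(2) 
    using borel_measurable_diff_null[of N UNIV h] by (simp add: lebesgue_on_UNIV_eq negligible_iff_null_sets)
qed

lemma isCont_eventually_eq:
  assumes "\<forall>\<^sub>F x' in nhds x. f x' = g x'" "isCont g x"
  shows "isCont f x"
  using isCont_cong[OF assms(1)] assms(2) by simp

lemma integrable_inner_gaussian:
  fixes w :: "real ^ 'n \<Rightarrow> real ^ 'n"
  assumes s: "\<sigma> > 0" and w: "w \<in> borel_measurable lebesgue"
    and bd: "AE y in lebesgue. norm (w y) \<le> C * (1 + norm (y - \<mu>))"
  shows "integrable lebesgue (\<lambda>y. gaussian_density \<mu> \<sigma> y * ((y - \<mu>) \<bullet> w y))"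
    and "integrable lebesgue (\<lambda>y. gaussian_density \<mu> \<sigma> y * ((y $ i - \<mu> $ i) * w y $ i))"
proof -
  have id: "(\<lambda>y. y) \<in> borel_measurable (lebesgue :: (real ^ 'n) measure)" by (intro measurable_completion) simp
  show "integrable lebesgue (\<lambda>y. gaussian_density \<mu> \<sigma> y * ((y - \<mu>) \<bullet> w y))"
  proof (rule quadratic_growth_gaussian_integrable[OF s])
    show "(\<lambda>y. (y - \<mu>) \<bullet> w y) \<in> borel_measurable lebesgue"
      using w id by (intro borel_measurable_inner borel_measurable_diff) auto
    show "AE y in lebesgue. \<bar>(y - \<mu>) \<bullet> w y\<bar> \<le> C * (1 + norm (y - \<mu>))\<^sup>2"
      using bd
    proof eventually_elim
      case (elim y)
      have "\<bar>(y - \<mu>) \<bullet> w y\<bar> \<le> norm (y - \<mu>) * norm (w y)" by (rule Cauchy_Schwarz_ineq2)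
      also have "\<dots> \<le> (1 + norm (y - \<mu>)) * (C * (1 + norm (y - \<mu>)))"
        using elim by (intro mult_mono) auto
      finally show ?case by (simp add: power2_eq_square mult_ac)
    qed
  qed
  show "integrable lebesgue (\<lambda>y. gaussian_density \<mu> \<sigma> y * ((y $ i - \<mu> $ i) * w y $ i))"
  proof (rule quadratic_growth_gaussian_integrable[OF s])
    show "(\<lambda>y. (y $ i - \<mu> $ i) * w y $ i) \<in> borel_measurable lebesgue"
      by (intro borel_measurable_times borel_measurable_diff borel_measurable_const
          measurable_compose[OF w] measurable_compose[OF id]) simp_all
    show "AE y in lebesgue. \<bar>(y $ i - \<mu> $ i) * w y $ i\<bar> \<le> C * (1 + norm (y - \<mu>))\<^sup>2"
      using bd
    proof eventually_elim
      case (elim y)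
      have "\<bar>(y $ i - \<mu> $ i) * w y $ i\<bar> \<le> (1 + norm (y - \<mu>)) * (C * (1 + norm (y - \<mu>)))"
        unfolding abs_mult
        using component_le_norm_cart[of "y - \<mu>" i] order_trans[OF component_le_norm_cart[of "w y" i] elim]
        by (intro mult_mono) auto
      then show ?case by (simp add: power2_eq_square mult_ac)
    qed
  qed
qed


section \<open>Locally linear estimators\<close>

text \<open>
  Here \<open>g\<close> plays the role of the lasso fit and \<open>f\<close> of the lasso-OLS estimator: almost everywhere
  \<open>f\<close> is locally the linear part \<open>P\<close> of the affine map \<open>g\<close>, but only \<open>g\<close> is continuous.
\<close>

locale locally_linear_estimator =
  fixes f g :: "real ^ 'n \<Rightarrow> real ^ 'n" and N :: "(real ^ 'n) set" and L :: real
  assumes lipschitz: "L-lipschitz_on UNIV g"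
    and closed: "closed N" and negligible: "negligible N"
    and locally_linear: "\<And>y. y \<notin> N \<Longrightarrow>
      \<exists>P. linear P \<and> (\<forall>\<^sub>F y' in nhds y. g y' - g y = P (y' - y) \<and> f y' = P y')"
begin

lemma AE_not_in_N: "AE y in lebesgue. y \<notin> N"
  using negligible by (intro AE_not_in) (simp add: negligible_iff_null_sets)

text \<open>One and the same \<open>P\<close> is the derivative on a whole neighbourhood, not only
  at \<open>y\<close>. Hence the derivative is locally constant off \<open>N\<close>, which makes
  the divergence measurable.\<close>

lemma derivative_f:
  assumes y: "y \<notin> N"
  obtains P where "linear P" "\<forall>\<^sub>F y' in nhds y. g y' - g y = P (y' - y)"
    "\<forall>\<^sub>F y' in nhds y. f y' = P y'" "\<forall>\<^sub>F y' in nhds y. (f has_derivative P) (at y')"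
proof -
  obtain P where P: "linear P" "\<forall>\<^sub>F y' in nhds y. g y' - g y = P (y' - y)" "\<forall>\<^sub>F y' in nhds y. f y' = P y'"
    using locally_linear[OF y] by (auto simp: eventually_conj_iff)
  have "\<forall>\<^sub>F y' in nhds y. \<forall>\<^sub>F y'' in nhds y'. f y'' = P y''"
    using P(3) by (simp add: eventually_eventually)
  then have "\<forall>\<^sub>F y' in nhds y. (f has_derivative P) (at y')"
  proof eventually_elim
    case (elim y')
    have "(P has_derivative P) (at y')" using P(1) by (rule linear_imp_has_derivative)
    then show ?case
      by (rule has_derivative_transform_eventually)
        (use elim in \<open>auto simp: eventually_at_filter eq_commute elim: eventually_mono dest: eventually_nhds_x_imp_x\<close>)
  qed
  with P show thesis by (rule that)
qed

lemma measurable_f: "f \<in> borel_measurable lebesgue"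
proof (rule lebesgue_measurable_if_isCont[OF closed negligible])
  fix y assume "y \<notin> N"
  then obtain P where P: "linear P" "\<forall>\<^sub>F y' in nhds y. f y' = P y'" by (rule derivative_f)
  then show "isCont f y"
    by (intro isCont_eventually_eq[of f P]) (auto simp: linear_continuous_at linear_conv_bounded_linear)
qed

lemma measurable_g: "g \<in> borel_measurable lebesgue"
  by (intro measurable_completion)
    (simp add: borel_measurable_continuous_onI lipschitz_on_continuous_on[OF lipschitz])

lemma AE_differentiable_f: "AE y in lebesgue. f differentiable (at y)"
  using AE_not_in_N
proof eventually_elim
  case (elim y)
  then obtain P where "\<forall>\<^sub>F y' in nhds y. (f has_derivative P) (at y')" by (rule derivative_f)
  then show ?case by (auto simp: differentiable_def dest: eventually_nhds_x_imp_x)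
qed

lemma measurable_partial: "(\<lambda>y. frechet_derivative f (at y) v $ i) \<in> borel_measurable lebesgue"
proof (rule lebesgue_measurable_if_isCont[OF closed negligible])
  fix y assume "y \<notin> N"
  then obtain P where "\<forall>\<^sub>F y' in nhds y. (f has_derivative P) (at y')" by (rule derivative_f)
  then have "\<forall>\<^sub>F y' in nhds y. frechet_derivative f (at y') v $ i = P v $ i"
    by (rule eventually_mono) (simp add: frechet_derivative_at[symmetric])
  then show "isCont (\<lambda>y. frechet_derivative f (at y) v $ i) y" by (rule isCont_eventually_eq) simp
qed

lemma measurable_divergence_f: "divergence f \<in> borel_measurable lebesgue"
  unfolding divergence_def[abs_def] by (intro borel_measurable_sum measurable_partial)

text \<open>Although \<open>f\<close> is not Lipschitz, it inherits linear growth from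
  \<open>g\<close>: \<open>f y = P y\<close> is the difference quotient of \<open>g\<close> at
  \<open>y\<close> in the direction \<open>y\<close> itself.\<close>

lemma norm_f_le:
  assumes "y \<notin> N"
  shows "norm (f y) \<le> L * norm y"
proof -
  obtain P where P: "linear P" "\<forall>\<^sub>F y' in nhds y. g y' - g y = P (y' - y)" "\<forall>\<^sub>F y' in nhds y. f y' = P y'"
    using assms by (rule derivative_f)
  have "((\<lambda>e. y + e *\<^sub>R y) \<longlongrightarrow> y) (at_right 0)" by (auto intro!: tendsto_eq_intros)
  then have "\<forall>\<^sub>F e in at_right 0. g (y + e *\<^sub>R y) - g y = P (y + e *\<^sub>R y - y)"
    by (rule eventually_compose_filterlim[OF P(2)])
  then have "\<forall>\<^sub>F e in at_right 0. e > 0 \<and> g (y + e *\<^sub>R y) - g y = P (y + e *\<^sub>R y - y)"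
    using eventually_at_right_less by (rule eventually_conj[rotated])
  then obtain e :: real where e: "e > 0" "g (y + e *\<^sub>R y) - g y = P (y + e *\<^sub>R y - y)"
    using eventually_happens' trivial_limit_at_right_real by blast
  have "e * norm (P y) = norm (g (y + e *\<^sub>R y) - g y)"
    using e P(1) by (simp add: linear_scale)
  also have "\<dots> \<le> L * norm (y + e *\<^sub>R y - y)"
    using lipschitz_onD[OF lipschitz, of "y + e *\<^sub>R y" y] by (simp add: dist_norm)
  also have "\<dots> = e * (L * norm y)" using e by simp
  finally have "norm (P y) \<le> L * norm y" using e by simp
  then show ?thesis using eventually_nhds_x_imp_x[OF P(3)] by simp
qed

lemma norm_g_le: "norm (g y) \<le> (norm (g \<mu>) + L) * (1 + norm (y - \<mu>))"
proof -
  have L: "L \<ge> 0" using lipschitz by (rule lipschitz_on_nonneg)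
  have "norm (g y) \<le> norm (g \<mu>) + norm (g y - g \<mu>)" by (metis add.commute norm_triangle_sub)
  also have "\<dots> \<le> norm (g \<mu>) + L * norm (y - \<mu>)"
    using lipschitz_onD[OF lipschitz, of y \<mu>] by (simp add: dist_norm)
  also have "\<dots> \<le> (norm (g \<mu>) + L) * (1 + norm (y - \<mu>))"
    using L by (simp add: algebra_simps)
  finally show ?thesis .
qed

lemma norm_f_le':
  assumes "y \<notin> N"
  shows "norm (f y) \<le> L * (1 + norm \<mu>) * (1 + norm (y - \<mu>))"
proof -
  have "norm y \<le> norm \<mu> + norm (y - \<mu>)" by (metis norm_triangle_sub)
  also have "\<dots> \<le> (1 + norm \<mu>) * (1 + norm (y - \<mu>))" by (simp add: algebra_simps)
  finally show ?thesis
    using norm_f_le[OF assms] lipschitz_on_nonneg[OF lipschitz] by (simp add: mult.assoc mult_left_mono order_trans)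
qed

lemma
  assumes s: "\<sigma> > 0"
  shows divergence_integrable: "integrable lebesgue (\<lambda>y. gaussian_density \<mu> \<sigma> y * divergence f y)"
    and stein_divergence: "(\<integral>y. gaussian_density \<mu> \<sigma> y * ((y - \<mu>) \<bullet> g y) \<partial>lebesgue)
      = \<sigma>\<^sup>2 * (\<integral>y. gaussian_density \<mu> \<sigma> y * divergence f y \<partial>lebesgue)"
proof -
  let ?\<phi> = "gaussian_density \<mu> \<sigma>"
  have lip: "L-lipschitz_on UNIV (\<lambda>y. g y $ i)" for i
  proof (rule lipschitz_onI)
    fix x y
    have "dist (g x $ i) (g y $ i) \<le> dist (g x) (g y)" by (rule dist_vec_nth_le)
    also have "\<dots> \<le> L * dist x y" by (rule lipschitz_onD[OF lipschitz]) auto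
    finally show "dist (g x $ i) (g y $ i) \<le> L * dist x y" .
  qed (rule lipschitz_on_nonneg[OF lipschitz])
  have deriv: "AE y in lebesgue. ((\<lambda>h. g (y + h *\<^sub>R axis i 1) $ i) has_real_derivative
      frechet_derivative f (at y) (axis i 1) $ i) (at 0)" for i
    using AE_not_in_N
  proof eventually_elim
    case (elim y)
    then obtain P where P: "linear P" "\<forall>\<^sub>F y' in nhds y. g y' - g y = P (y' - y)"
      "\<forall>\<^sub>F y' in nhds y. (f has_derivative P) (at y')" by (rule derivative_f)
    have "filterlim (\<lambda>h. y + h *\<^sub>R axis i 1) (nhds y) (nhds 0)"
      by (auto intro!: tendsto_eq_intros filterlim_ident)
    then have "\<forall>\<^sub>F h in nhds 0. g (y + h *\<^sub>R axis i 1) - g y = P (y + h *\<^sub>R axis i 1 - y)"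
      by (rule eventually_compose_filterlim[OF P(2)])
    then have "\<forall>\<^sub>F h in nhds 0. g (y + h *\<^sub>R axis i 1) $ i = g y $ i + h * P (axis i 1) $ i"
    proof eventually_elim
      case (elim h)
      have "g (y + h *\<^sub>R axis i 1) = g y + h *\<^sub>R P (axis i 1)"
        using elim P(1) by (simp add: linear_scale algebra_simps)
      then show ?case by simp
    qed
    moreover have "((\<lambda>h. g y $ i + h * P (axis i 1) $ i) has_real_derivative P (axis i 1) $ i) (at 0)"
      by (auto intro!: derivative_eq_intros)
    ultimately have "((\<lambda>h. g (y + h *\<^sub>R axis i 1) $ i) has_real_derivative P (axis i 1) $ i) (at 0)"
      by (simp add: DERIV_cong_ev)
    moreover have "frechet_derivative f (at y) = P"
      using eventually_nhds_x_imp_x[OF P(3)] by (simp add: frechet_derivative_at[symmetric])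
    ultimately show ?case by simp
  qed
  \<comment> \<open>The identity is applied to the components of \<open>g\<close>, with the partial
    derivatives of \<open>f\<close> in the role of \<open>D\<close>: near a point off
    \<open>N\<close> both maps have derivative \<open>P\<close>.\<close>
  note stein = stein_identity[OF s lip measurable_partial deriv, of \<mu>]
  show "integrable lebesgue (\<lambda>y. ?\<phi> y * divergence f y)"
    unfolding divergence_def sum_distrib_left by (intro Bochner_Integration.integrable_sum stein)
  note gi = integrable_inner_gaussian(2)[OF s measurable_g AE_I2[OF norm_g_le]]
  have "(\<integral>y. ?\<phi> y * ((y - \<mu>) \<bullet> g y) \<partial>lebesgue) = (\<Sum>i\<in>UNIV. \<integral>y. ?\<phi> y * ((y $ i - \<mu> $ i) * g y $ i) \<partial>lebesgue)"
    using gi by (simp add: inner_vec_def sum_distrib_left Bochner_Integration.integral_sum)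
  also have "\<dots> = (\<Sum>i\<in>UNIV. \<sigma>\<^sup>2 * (\<integral>y. ?\<phi> y * frechet_derivative f (at y) (axis i 1) $ i \<partial>lebesgue))"
    by (intro sum.cong refl stein)
  also have "\<dots> = \<sigma>\<^sup>2 * (\<integral>y. ?\<phi> y * divergence f y \<partial>lebesgue)"
    using stein(1) by (simp add: divergence_def sum_distrib_left Bochner_Integration.integral_sum)
  finally show "(\<integral>y. ?\<phi> y * ((y - \<mu>) \<bullet> g y) \<partial>lebesgue) = \<sigma>\<^sup>2 * (\<integral>y. ?\<phi> y * divergence f y \<partial>lebesgue)" .
qed

text \<open>A linear \<open>P\<close> commutes with dilations, so the same \<open>P\<close> and the
  same Lipschitz constant serve after conjugation. An analysis at parameter 1 thus covers all
  parameters.\<close>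

lemma scaled:
  assumes t: "t > 0"
  shows "locally_linear_estimator (\<lambda>y. t *\<^sub>R f (y /\<^sub>R t)) (\<lambda>y. t *\<^sub>R g (y /\<^sub>R t)) ((*\<^sub>R) t ` N) L"
proof
  show "L-lipschitz_on UNIV (\<lambda>y. t *\<^sub>R g (y /\<^sub>R t))"
  proof (rule lipschitz_onI)
    fix x y
    have "dist (g (x /\<^sub>R t)) (g (y /\<^sub>R t)) \<le> L * dist (x /\<^sub>R t) (y /\<^sub>R t)"
      by (rule lipschitz_onD[OF lipschitz]) auto
    moreover have "dist (c *\<^sub>R u) (c *\<^sub>R v) = c * dist u v" if "c > 0" for c :: real and u v :: "real ^ 'n"
      using that by (simp add: dist_norm flip: scaleR_right_diff_distrib)
    ultimately show "dist (t *\<^sub>R g (x /\<^sub>R t)) (t *\<^sub>R g (y /\<^sub>R t)) \<le> L * dist x y"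
      using t by (simp add: field_simps)
  qed (rule lipschitz_on_nonneg[OF lipschitz])
  show "closed ((*\<^sub>R) t ` N)" using closed by (rule closed_scaling)
  show "negligible ((*\<^sub>R) t ` N)" using negligible
    by (intro negligible_differentiable_image_negligible) (auto intro!: derivative_intros)
  fix y assume y: "y \<notin> (*\<^sub>R) t ` N"
  have "y /\<^sub>R t \<notin> N"
  proof
    assume "y /\<^sub>R t \<in> N"
    then have "t *\<^sub>R (y /\<^sub>R t) \<in> (*\<^sub>R) t ` N" by (rule imageI)
    with y t show False by simp
  qed
  then obtain P where P: "linear P"
    "\<forall>\<^sub>F z in nhds (y /\<^sub>R t). g z - g (y /\<^sub>R t) = P (z - y /\<^sub>R t) \<and> f z = P z"
    using locally_linear by blast
  have "filterlim (\<lambda>y'. y' /\<^sub>R t) (nhds (y /\<^sub>R t)) (nhds y)" by (intro tendsto_intros filterlim_ident)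
  then have "\<forall>\<^sub>F y' in nhds y. g (y' /\<^sub>R t) - g (y /\<^sub>R t) = P (y' /\<^sub>R t - y /\<^sub>R t) \<and> f (y' /\<^sub>R t) = P (y' /\<^sub>R t)"
    by (rule eventually_compose_filterlim[OF P(2)])
  then have "\<forall>\<^sub>F y' in nhds y. t *\<^sub>R g (y' /\<^sub>R t) - t *\<^sub>R g (y /\<^sub>R t) = P (y' - y) \<and> t *\<^sub>R f (y' /\<^sub>R t) = P y'"
  proof eventually_elim
    case (elim y')
    have P_scale: "t *\<^sub>R P (x /\<^sub>R t) = P x" for x using P(1) t by (simp add: linear_scale)
    have "t *\<^sub>R g (y' /\<^sub>R t) - t *\<^sub>R g (y /\<^sub>R t) = t *\<^sub>R P ((y' - y) /\<^sub>R t)"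
      using elim by (simp only: scaleR_right_diff_distrib[symmetric])
    with elim show ?case by (simp only: P_scale)
  qed
  with P(1) show "\<exists>P. linear P \<and> (\<forall>\<^sub>F y' in nhds y. t *\<^sub>R g (y' /\<^sub>R t) - t *\<^sub>R g (y /\<^sub>R t) = P (y' - y) \<and> t *\<^sub>R f (y' /\<^sub>R t) = P y')"
    by blast
qed

section \<open>Degrees of freedom of a locally linear estimator as Lebesgue integrals\<close>

lemma stein_df_exists_f:
  assumes s: "\<sigma> > 0" and Y: "distributed M lborel Y (\<lambda>y. ennreal (gaussian_density \<mu> \<sigma> y))"
  shows "stein_df_exists M Y f"
  unfolding stein_df_exists_def integrable_gaussian[OF s Y measurable_divergence_f]
  using measurable_f AE_differentiable_f divergence_integrable[OF s] by blast

text \<open>The divergence has disappeared: this form depends on the continuous map only and can be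
  differentiated in a scale parameter.\<close>

lemma stein_df_f:
  assumes s: "\<sigma> > 0" and Y: "distributed M lborel Y (\<lambda>y. ennreal (gaussian_density \<mu> \<sigma> y))"
  shows "stein_df M Y f = (\<integral>y. gaussian_density \<mu> \<sigma> y * ((y - \<mu>) \<bullet> g y) \<partial>lebesgue) / \<sigma>\<^sup>2"
  unfolding stein_df_def integral_gaussian[OF s Y measurable_divergence_f] stein_divergence[OF s]
  using s by simp

lemma df_exists_f:
  assumes s: "\<sigma> > 0" and Y: "distributed M lborel Y (\<lambda>y. ennreal (gaussian_density \<mu> \<sigma> y))"
  shows "df_exists M Y f"
proof -
  have m: "(\<lambda>y. (norm (f y))\<^sup>2) \<in> borel_measurable lebesgue"
    using measurable_compose[OF measurable_f, of "\<lambda>x. (norm x)\<^sup>2" borel] by simp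
  have "AE y in lebesgue. \<bar>(norm (f y))\<^sup>2\<bar> \<le> (L * (1 + norm \<mu>))\<^sup>2 * (1 + norm (y - \<mu>))\<^sup>2"
    using AE_not_in_N
  proof eventually_elim
    case (elim y)
    then show ?case
      using norm_f_le'[of y \<mu>] by (simp add: power_mono flip: power_mult_distrib)
  qed
  then show ?thesis
    unfolding df_exists_def integrable_gaussian[OF s Y m]
    using measurable_f quadratic_growth_gaussian_integrable[OF s m] by blast
qed

text \<open>As \<open>Y - \<mu>\<close> is centred, the mean of \<open>f\<close> drops out of every
  covariance.\<close>

lemma df_f:
  assumes M: "prob_space M" and s: "\<sigma> > 0"
    and Y: "distributed M lborel Y (\<lambda>y. ennreal (gaussian_density \<mu> \<sigma> y))"
  shows "df M Y \<sigma> f = (\<integral>y. gaussian_density \<mu> \<sigma> y * ((y - \<mu>) \<bullet> f y) \<partial>lebesgue) / \<sigma>\<^sup>2"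
proof -
  let ?\<phi> = "gaussian_density \<mu> \<sigma>"
  have bd: "AE y in lebesgue. norm (f y) \<le> L * (1 + norm \<mu>) * (1 + norm (y - \<mu>))"
    using AE_not_in_N norm_f_le' by (rule eventually_mono)
  note int = integrable_inner_gaussian(2)[OF s measurable_f bd]
  have nth: "(\<lambda>y. y $ i) \<in> borel_measurable (lebesgue :: (real ^ 'n) measure)" for i
    by (intro measurable_completion) simp
  have fm: "(\<lambda>y. f y $ i) \<in> borel_measurable lebesgue" for i
    using measurable_compose[OF measurable_f, of "\<lambda>x. x $ i" borel] by simp
  have total: "(\<integral>y. ?\<phi> y \<partial>lebesgue) = 1"
    using integral_gaussian[OF s Y, of "\<lambda>_. 1"] prob_space.prob_space[OF M] by (simp add: integral_completion)
  have centered: "integrable lebesgue (\<lambda>y. ?\<phi> y * (y $ i - \<mu> $ i))"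
    "(\<integral>y. ?\<phi> y * (y $ i - \<mu> $ i) \<partial>lebesgue) = 0" for i
  proof -
    \<comment> \<open>Stein's identity for the constant function 1, whose derivative is 0, shows
      that the coordinates have mean \<open>\<mu> $ i\<close>.\<close>
    have "0-lipschitz_on UNIV (\<lambda>_::real ^ 'n. 1::real)" by (rule lipschitz_onI) auto
    from stein_identity(2)[OF s this, where D="\<lambda>_. 0" and i=i and \<mu>=\<mu>]
    show "(\<integral>y. ?\<phi> y * (y $ i - \<mu> $ i) \<partial>lebesgue) = 0" by simp
    show "integrable lebesgue (\<lambda>y. ?\<phi> y * (y $ i - \<mu> $ i))"
      using integrable_inner_gaussian(2)[OF s, where w="\<lambda>_. axis i 1" and C=1 and \<mu>=\<mu> and i=i] by simp
  qed
  have mean: "(\<integral>\<omega>. Y \<omega> $ i \<partial>completion M) = \<mu> $ i" for i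
  proof -
    have "(\<integral>\<omega>. Y \<omega> $ i \<partial>completion M) = (\<integral>y. ?\<phi> y * y $ i \<partial>lebesgue)"
      by (rule integral_gaussian[OF s Y nth])
    also have "\<dots> = (\<integral>y. ?\<phi> y * (y $ i - \<mu> $ i) + ?\<phi> y * \<mu> $ i \<partial>lebesgue)"
      by (intro Bochner_Integration.integral_cong) (auto simp: algebra_simps)
    also have "\<dots> = \<mu> $ i"
      using centered[of i] gaussian_density_integrable[OF s, of \<mu>] total
      by (simp add: Bochner_Integration.integral_add integrable_mult_left)
    finally show ?thesis .
  qed
  have cov: "covariance (completion M) (\<lambda>\<omega>. Y \<omega> $ i) (\<lambda>\<omega>. f (Y \<omega>) $ i)
      = (\<integral>y. ?\<phi> y * ((y $ i - \<mu> $ i) * f y $ i) \<partial>lebesgue)" for i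
  proof -
    define v where "v = (\<integral>\<omega>. f (Y \<omega>) $ i \<partial>completion M)"
    have "covariance (completion M) (\<lambda>\<omega>. Y \<omega> $ i) (\<lambda>\<omega>. f (Y \<omega>) $ i)
        = (\<integral>y. ?\<phi> y * ((y $ i - \<mu> $ i) * (f y $ i - v)) \<partial>lebesgue)"
      unfolding covariance_def mean v_def[symmetric]
      using nth fm by (intro integral_gaussian[OF s Y]) auto
    also have "\<dots> = (\<integral>y. ?\<phi> y * ((y $ i - \<mu> $ i) * f y $ i) - ?\<phi> y * (y $ i - \<mu> $ i) * v \<partial>lebesgue)"
      by (intro Bochner_Integration.integral_cong) (auto simp: algebra_simps)
    also have "\<dots> = (\<integral>y. ?\<phi> y * ((y $ i - \<mu> $ i) * f y $ i) \<partial>lebesgue)"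
      using int centered by simp
    finally show ?thesis .
  qed
  have "(\<integral>y. ?\<phi> y * ((y - \<mu>) \<bullet> f y) \<partial>lebesgue) = (\<Sum>i\<in>UNIV. \<integral>y. ?\<phi> y * ((y $ i - \<mu> $ i) * f y $ i) \<partial>lebesgue)"
    using int by (simp add: inner_vec_def sum_distrib_left Bochner_Integration.integral_sum)
  then show ?thesis unfolding df_def cov by (simp add: sum_divide_distrib)
qed

text \<open>For \<open>t\<close> near \<open>l\<close> the point \<open>y / t\<close> stays where
  \<open>g\<close> is affine with linear part \<open>P\<close>, and \<open>t (y / t - y / l)\<close>
  is a multiple of \<open>y\<close>, on which \<open>P\<close> is known from \<open>f\<close>. The
  slope, multiplied by \<open>l\<close>, is the scaled fit minus the scaled estimator.\<close>

lemma scaled_fit_eventually_linear: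
  assumes l: "l > 0" and y: "y /\<^sub>R l \<notin> N"
  shows "\<forall>\<^sub>F t in nhds l. t *\<^sub>R g (y /\<^sub>R t) - l *\<^sub>R g (y /\<^sub>R l) = (t - l) *\<^sub>R (g (y /\<^sub>R l) - f (y /\<^sub>R l))"
proof -
  obtain P where P: "linear P" "\<forall>\<^sub>F z in nhds (y /\<^sub>R l). g z - g (y /\<^sub>R l) = P (z - y /\<^sub>R l)"
    "\<forall>\<^sub>F z in nhds (y /\<^sub>R l). f z = P z"
    using y by (rule derivative_f)
  have Py: "P y = l *\<^sub>R f (y /\<^sub>R l)"
    using eventually_nhds_x_imp_x[OF P(3)] P(1) l by (simp add: linear_scale)
  have "filterlim (\<lambda>t. y /\<^sub>R t) (nhds (y /\<^sub>R l)) (nhds l)"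
    using l by (auto intro!: tendsto_intros filterlim_ident)
  then have "\<forall>\<^sub>F t in nhds l. g (y /\<^sub>R t) - g (y /\<^sub>R l) = P (y /\<^sub>R t - y /\<^sub>R l)"
    by (rule eventually_compose_filterlim[OF P(2)])
  moreover have "\<forall>\<^sub>F t in nhds l. t > 0"
    using l eventually_nhds_in_open[of "{0<..}" l] by simp
  ultimately show ?thesis
  proof eventually_elim
    case (elim t)
    have "t *\<^sub>R (g (y /\<^sub>R t) - g (y /\<^sub>R l)) = P (t *\<^sub>R (y /\<^sub>R t - y /\<^sub>R l))"
      using elim(1) P(1) by (simp only: linear_scale)
    also have "t *\<^sub>R (y /\<^sub>R t - y /\<^sub>R l) = (1 - t / l) *\<^sub>R y"
      using elim(2) by (simp add: scaleR_right_diff_distrib scaleR_left_diff_distrib divide_inverse)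
    also have "1 - t / l = (l - t) / l" using l by (simp add: field_simps)
    also have "P (((l - t) / l) *\<^sub>R y) = (l - t) *\<^sub>R f (y /\<^sub>R l)"
      using P(1) l by (simp add: linear_scale Py)
    finally have "t *\<^sub>R g (y /\<^sub>R t) = t *\<^sub>R g (y /\<^sub>R l) + (l - t) *\<^sub>R f (y /\<^sub>R l)"
      by (simp add: scaleR_right_diff_distrib algebra_simps)
    then show ?case by (simp add: scaleR_right_diff_distrib scaleR_left_diff_distrib)
  qed
qed

text \<open>The dominating bound for difference quotients in \<open>t\<close>. The condition on
  \<open>t\<close> gives \<open>1 / t \<le> 2 / l\<close>; the 4 is 2 from the growth of
  \<open>g\<close> at \<open>y / t\<close> plus 2 from the displacement between \<open>y / t\<close>
  and \<open>y / l\<close>.\<close>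

lemma scaled_fit_lipschitz:
  assumes l: "l > 0" and t: "t > l / 2"
  shows "norm (t *\<^sub>R g (y /\<^sub>R t) - l *\<^sub>R g (y /\<^sub>R l)) \<le> \<bar>t - l\<bar> * (norm (g 0) + 4 * L / l * norm y)"
proof -
  have t0: "t > 0" using l t by simp
  have L: "L \<ge> 0" using lipschitz by (rule lipschitz_on_nonneg)
  have it: "1 / t \<le> 2 / l" using l t t0 by (simp add: field_simps)
  have "norm (g (y /\<^sub>R t)) \<le> norm (g 0) + norm (g (y /\<^sub>R t) - g 0)" by (metis add.commute norm_triangle_sub)
  also have "norm (g (y /\<^sub>R t) - g 0) \<le> L * norm (y /\<^sub>R t)"
    using lipschitz_onD[OF lipschitz, of "y /\<^sub>R t" 0] by (simp add: dist_norm)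
  also have "\<dots> = L * norm y * (1 / t)" using t0 by (simp add: field_simps)
  also have "\<dots> \<le> L * norm y * (2 / l)" using L it by (intro mult_left_mono) auto
  finally have 1: "norm (g (y /\<^sub>R t)) \<le> norm (g 0) + 2 * L / l * norm y" by (simp add: mult_ac)
  have "norm (g (y /\<^sub>R t) - g (y /\<^sub>R l)) \<le> L * norm (y /\<^sub>R t - y /\<^sub>R l)"
    using lipschitz_onD[OF lipschitz, of "y /\<^sub>R t" "y /\<^sub>R l"] by (simp add: dist_norm)
  also have "y /\<^sub>R t - y /\<^sub>R l = ((l - t) / (t * l)) *\<^sub>R y"
    using l t0 by (simp add: field_simps flip: scaleR_left_diff_distrib)
  also have "L * norm (((l - t) / (t * l)) *\<^sub>R y) = (L * norm y * \<bar>t - l\<bar> / l) * (1 / t)"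
    using l t0 by (simp add: abs_mult abs_minus_commute field_simps)
  also have "\<dots> \<le> (L * norm y * \<bar>t - l\<bar> / l) * (2 / l)" using L it l by (intro mult_left_mono) auto
  finally have 2: "l * norm (g (y /\<^sub>R t) - g (y /\<^sub>R l)) \<le> \<bar>t - l\<bar> * (2 * L / l * norm y)"
    using l by (simp add: field_simps)
  have "t *\<^sub>R g (y /\<^sub>R t) - l *\<^sub>R g (y /\<^sub>R l) = (t - l) *\<^sub>R g (y /\<^sub>R t) + l *\<^sub>R (g (y /\<^sub>R t) - g (y /\<^sub>R l))"
    by (simp add: algebra_simps)
  then have "norm (t *\<^sub>R g (y /\<^sub>R t) - l *\<^sub>R g (y /\<^sub>R l))
      \<le> \<bar>t - l\<bar> * norm (g (y /\<^sub>R t)) + l * norm (g (y /\<^sub>R t) - g (y /\<^sub>R l))"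
    using l norm_triangle_ineq[of "(t - l) *\<^sub>R g (y /\<^sub>R t)" "l *\<^sub>R (g (y /\<^sub>R t) - g (y /\<^sub>R l))"] by simp
  also have "\<dots> \<le> \<bar>t - l\<bar> * (norm (g 0) + 2 * L / l * norm y) + \<bar>t - l\<bar> * (2 * L / l * norm y)"
    using 1 2 by (intro add_mono mult_left_mono) auto
  finally show ?thesis by (simp add: algebra_simps)
qed

lemma scaled_fit_integral_has_derivative:
  assumes s: "\<sigma> > 0" and l: "l > 0"
  shows "((\<lambda>t. \<integral>y. gaussian_density \<mu> \<sigma> y * ((y - \<mu>) \<bullet> (t *\<^sub>R g (y /\<^sub>R t))) \<partial>lebesgue) has_real_derivative
      (\<integral>y. gaussian_density \<mu> \<sigma> y * ((y - \<mu>) \<bullet> (g (y /\<^sub>R l) - f (y /\<^sub>R l))) \<partial>lebesgue)) (at l)"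
proof -
  let ?\<phi> = "gaussian_density \<mu> \<sigma>"
  let ?G = "\<lambda>t y. t *\<^sub>R g (y /\<^sub>R t)"
  let ?h = "\<lambda>y. g (y /\<^sub>R l) - f (y /\<^sub>R l)"
  define B where "B = norm (g 0) + 4 * L / l * (1 + norm \<mu>)"
  have L: "L \<ge> 0" using lipschitz by (rule lipschitz_on_nonneg)
  interpret l: locally_linear_estimator "\<lambda>y. l *\<^sub>R f (y /\<^sub>R l)" "\<lambda>y. l *\<^sub>R g (y /\<^sub>R l)" "(*\<^sub>R) l ` N" L
    by (rule scaled[OF l])
  have Gm: "?G t \<in> borel_measurable lebesgue" if "t > 0" for t
  proof -
    interpret t: locally_linear_estimator "\<lambda>y. t *\<^sub>R f (y /\<^sub>R t)" "\<lambda>y. t *\<^sub>R g (y /\<^sub>R t)" "(*\<^sub>R) t ` N" L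
      using that by (rule scaled)
    show ?thesis by (rule t.measurable_g)
  qed
  have Gi: "integrable lebesgue (\<lambda>y. ?\<phi> y * ((y - \<mu>) \<bullet> ?G t y))" if "t > 0" for t
  proof -
    interpret t: locally_linear_estimator "\<lambda>y. t *\<^sub>R f (y /\<^sub>R t)" "\<lambda>y. t *\<^sub>R g (y /\<^sub>R t)" "(*\<^sub>R) t ` N" L
      using that by (rule scaled)
    show ?thesis by (rule integrable_inner_gaussian(1)[OF s t.measurable_g AE_I2[OF t.norm_g_le]])
  qed
  have hm: "?h \<in> borel_measurable lebesgue"
  proof -
    have "(\<lambda>y. (l *\<^sub>R g (y /\<^sub>R l) - l *\<^sub>R f (y /\<^sub>R l)) /\<^sub>R l) \<in> borel_measurable lebesgue"
      using measurable_compose[OF borel_measurable_diff[OF l.measurable_g l.measurable_f], of "\<lambda>x. x /\<^sub>R l" borel] by simp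
    then show ?thesis using l by (simp flip: scaleR_right_diff_distrib)
  qed
  have id: "(\<lambda>y. y) \<in> borel_measurable (lebesgue :: (real ^ 'n) measure)" by (intro measurable_completion) simp
  let ?q = "\<lambda>t y. (?G t y - ?G l y) /\<^sub>R (t - l)"
  have qb: "norm (?q t y) \<le> B * (1 + norm (y - \<mu>))" if "t > l / 2" "t \<noteq> l" for t y
  proof -
    have "norm y \<le> norm \<mu> + norm (y - \<mu>)" by (metis norm_triangle_sub)
    also have "\<dots> \<le> (1 + norm \<mu>) * (1 + norm (y - \<mu>))" by (simp add: algebra_simps)
    finally have y: "norm y \<le> (1 + norm \<mu>) * (1 + norm (y - \<mu>))" .
    have "norm (?q t y) = norm (?G t y - ?G l y) / \<bar>t - l\<bar>" by (simp add: divide_inverse mult.commute)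
    also have "\<dots> \<le> norm (g 0) + 4 * L / l * norm y"
      using scaled_fit_lipschitz[OF l that(1), of y] that(2) by (simp add: pos_divide_le_eq mult.commute)
    also have "\<dots> \<le> norm (g 0) * (1 + norm (y - \<mu>)) + 4 * L / l * ((1 + norm \<mu>) * (1 + norm (y - \<mu>)))"
      using L l y by (intro add_mono mult_left_mono) (auto simp: mult_le_cancel_left1)
    also have "\<dots> = B * (1 + norm (y - \<mu>))" by (simp only: B_def distrib_right mult.assoc)
    finally show ?thesis .
  qed
  \<comment> \<open>The bound \<open>qb\<close> is available only for \<open>t > l / 2\<close>. This
    half-line is open and contains \<open>l\<close>, so the restriction does not change the
    limit.\<close>
  have "((\<lambda>t. ((\<integral>y. ?\<phi> y * ((y - \<mu>) \<bullet> ?G t y) \<partial>lebesgue) - (\<integral>y. ?\<phi> y * ((y - \<mu>) \<bullet> ?G l y) \<partial>lebesgue)) / (t - l))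
      \<longlongrightarrow> (\<integral>y. ?\<phi> y * ((y - \<mu>) \<bullet> ?h y) \<partial>lebesgue)) (at l within {l/2<..})"
    unfolding tendsto_at_iff_sequentially comp_def
  proof (intro allI impI)
    fix T assume "\<forall>k. T k \<in> {l / 2<..} - {l}" and Tl: "T \<longlonglongrightarrow> l"
    then have T: "T k > l / 2" "T k \<noteq> l" "T k > 0" for k using l by (auto intro: less_trans[of 0 "l/2"])
    have "(\<lambda>k. \<integral>y. ?\<phi> y * ((y - \<mu>) \<bullet> ?q (T k) y) \<partial>lebesgue) \<longlonglongrightarrow> (\<integral>y. ?\<phi> y * ((y - \<mu>) \<bullet> ?h y) \<partial>lebesgue)"
    proof (rule integral_dominated_convergence)
      have weighted: "(\<lambda>y. ?\<phi> y * ((y - \<mu>) \<bullet> w y)) \<in> borel_measurable lebesgue"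
        if "w \<in> borel_measurable lebesgue" for w :: "real ^ 'n \<Rightarrow> real ^ 'n"
        by (intro borel_measurable_times[OF lebesgue_measurable_gaussian_density]
            borel_measurable_inner[OF borel_measurable_diff[OF id] that] borel_measurable_const)
      show "(\<lambda>y. ?\<phi> y * ((y - \<mu>) \<bullet> ?h y)) \<in> borel_measurable lebesgue"
        using hm by (rule weighted)
      have "?q (T k) \<in> borel_measurable lebesgue" for k
        using measurable_compose[OF borel_measurable_diff[OF Gm[OF T(3)] Gm[OF l]], of "\<lambda>x. x /\<^sub>R (T k - l)" borel k]
        by simp
      then show "(\<lambda>y. ?\<phi> y * ((y - \<mu>) \<bullet> ?q (T k) y)) \<in> borel_measurable lebesgue" for k
        by (rule weighted)
      show "integrable lebesgue (\<lambda>y. ?\<phi> y * (B * (1 + norm (y - \<mu>))\<^sup>2))"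
        by (rule quadratic_growth_gaussian_integrable[OF s _ AE_I2, where C="\<bar>B\<bar>"])
          (auto simp: abs_mult intro!: measurable_completion)
      show "AE y in lebesgue. norm (?\<phi> y * ((y - \<mu>) \<bullet> ?q (T k) y)) \<le> ?\<phi> y * (B * (1 + norm (y - \<mu>))\<^sup>2)" for k
      proof (rule AE_I2)
        fix y
        have "\<bar>(y - \<mu>) \<bullet> ?q (T k) y\<bar> \<le> norm (y - \<mu>) * norm (?q (T k) y)" by (rule Cauchy_Schwarz_ineq2)
        also have "\<dots> \<le> (1 + norm (y - \<mu>)) * (B * (1 + norm (y - \<mu>)))"
          using qb[OF T(1,2)] by (intro mult_mono) auto
        also have "\<dots> = B * (1 + norm (y - \<mu>))\<^sup>2" by (simp add: power2_eq_square)
        finally show "norm (?\<phi> y * ((y - \<mu>) \<bullet> ?q (T k) y)) \<le> ?\<phi> y * (B * (1 + norm (y - \<mu>))\<^sup>2)"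
          unfolding real_norm_def abs_mult abs_of_nonneg[OF gaussian_density_nonneg]
          by (rule mult_left_mono) simp
      qed
      show "AE y in lebesgue. (\<lambda>k. ?\<phi> y * ((y - \<mu>) \<bullet> ?q (T k) y)) \<longlonglongrightarrow> ?\<phi> y * ((y - \<mu>) \<bullet> ?h y)"
        using l.AE_not_in_N
      proof eventually_elim
        case (elim y)
        \<comment> \<open>Only the exceptional set of the single parameter \<open>l\<close> is
          discarded. At such \<open>y\<close> the quotients equal the slope exactly for all large
          \<open>k\<close>, so no union of null sets over the parameters arises.\<close>
        have "y /\<^sub>R l \<notin> N"
        proof
          assume "y /\<^sub>R l \<in> N"
          then have "l *\<^sub>R (y /\<^sub>R l) \<in> (*\<^sub>R) l ` N" by (rule imageI)
          with elim l show False by simp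
        qed
        from scaled_fit_eventually_linear[OF l this] Tl
        have "\<forall>\<^sub>F k in sequentially. ?G (T k) y - ?G l y = (T k - l) *\<^sub>R ?h y"
          by (rule eventually_compose_filterlim)
        then have "\<forall>\<^sub>F k in sequentially. ?q (T k) y = ?h y"
        proof eventually_elim
          case (elim k)
          show ?case using T(2)[of k] unfolding elim by simp
        qed
        then have "(\<lambda>k. ?q (T k) y) \<longlonglongrightarrow> ?h y" by (rule tendsto_eventually)
        then show ?case by (intro tendsto_intros)
      qed
    qed
    moreover have "(\<integral>y. ?\<phi> y * ((y - \<mu>) \<bullet> ?q (T k) y) \<partial>lebesgue)
      = ((\<integral>y. ?\<phi> y * ((y - \<mu>) \<bullet> ?G (T k) y) \<partial>lebesgue) - (\<integral>y. ?\<phi> y * ((y - \<mu>) \<bullet> ?G l y) \<partial>lebesgue)) / (T k - l)" for k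
    proof -
      have "(\<integral>y. ?\<phi> y * ((y - \<mu>) \<bullet> ?q (T k) y) \<partial>lebesgue)
        = (\<integral>y. (?\<phi> y * ((y - \<mu>) \<bullet> ?G (T k) y) - ?\<phi> y * ((y - \<mu>) \<bullet> ?G l y)) / (T k - l) \<partial>lebesgue)"
        by (intro Bochner_Integration.integral_cong refl) (simp only: inner_scaleR_right inner_diff_right, simp add: divide_inverse algebra_simps)
      also have "\<dots> = ((\<integral>y. ?\<phi> y * ((y - \<mu>) \<bullet> ?G (T k) y) \<partial>lebesgue) - (\<integral>y. ?\<phi> y * ((y - \<mu>) \<bullet> ?G l y) \<partial>lebesgue)) / (T k - l)"
        using Gi[OF T(3)[of k]] Gi[OF l] by (simp only: integral_divide_zero Bochner_Integration.integral_diff)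
      finally show ?thesis .
    qed
    ultimately show "(\<lambda>k. ((\<integral>y. ?\<phi> y * ((y - \<mu>) \<bullet> ?G (T k) y) \<partial>lebesgue) - (\<integral>y. ?\<phi> y * ((y - \<mu>) \<bullet> ?G l y) \<partial>lebesgue)) / (T k - l))
      \<longlonglongrightarrow> (\<integral>y. ?\<phi> y * ((y - \<mu>) \<bullet> ?h y) \<partial>lebesgue)"
      by simp
  qed
  moreover have "at l within {l/2<..} = at l" using l by (intro at_within_open) auto
  ultimately show ?thesis by (simp add: has_field_derivative_iff)
qed

end


section \<open>Local structure of the lasso\<close>

lemma orth_proj_unique:
  assumes S: "subspace S" and z: "z \<in> S" "\<And>w. w \<in> S \<Longrightarrow> orthogonal (y - z) w"
  shows "orth_proj S y = z"
  unfolding orth_proj_def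
proof (rule the_equality)
  fix z' assume z': "z' \<in> S \<and> (\<forall>w\<in>S. orthogonal (y - z') w)"
  have "z - z' \<in> S" using S z z' by (auto intro: subspace_diff)
  then have "orthogonal (y - z') (z - z')" "orthogonal (y - z) (z - z')" using z z' by auto
  then have "orthogonal (z - z') (z - z')"
    by (auto simp: orthogonal_def inner_diff_left)
  then show "z' = z" by (simp add: orthogonal_def)
qed (use z in auto)

lemma
  assumes S: "subspace S"
  shows orth_proj_in: "orth_proj S y \<in> S"
    and orth_proj_orthogonal: "w \<in> S \<Longrightarrow> orthogonal (y - orth_proj S y) w"
proof -
  obtain a b where ab: "a \<in> span S" "\<And>w. w \<in> span S \<Longrightarrow> orthogonal b w" "y = a + b"
    using orthogonal_subspace_decomp_exists[of S y] by blast
  have span: "span S = S" using S by (rule span_eq_iff[THEN iffD2])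
  have "orth_proj S y = a"
    using ab S by (intro orth_proj_unique) (auto simp: span)
  with ab show "orth_proj S y \<in> S" "w \<in> S \<Longrightarrow> orthogonal (y - orth_proj S y) w"
    by (auto simp: span)
qed

lemma linear_orth_proj:
  assumes S: "subspace S"
  shows "linear (orth_proj S)"
proof (rule linearI)
  fix x y c
  show "orth_proj S (x + y) = orth_proj S x + orth_proj S y"
  proof (rule orth_proj_unique[OF S])
    fix w assume "w \<in> S"
    then have "orthogonal ((x - orth_proj S x) + (y - orth_proj S y)) w"
      by (intro orthogonal_clauses orth_proj_orthogonal[OF S])
    then show "orthogonal (x + y - (orth_proj S x + orth_proj S y)) w" by (simp add: algebra_simps)
  qed (intro subspace_add S orth_proj_in)
  show "orth_proj S (c *\<^sub>R x) = c *\<^sub>R orth_proj S x"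
  proof (rule orth_proj_unique[OF S])
    fix w assume "w \<in> S"
    then have "orthogonal (c *\<^sub>R (x - orth_proj S x)) w"
      by (intro orthogonal_clauses orth_proj_orthogonal[OF S])
    then show "orthogonal (c *\<^sub>R x - c *\<^sub>R orth_proj S x) w" by (simp add: algebra_simps)
  qed (intro subspace_scale S orth_proj_in)
qed

lemma orth_proj_id:
  assumes "subspace S" "y \<in> S"
  shows "orth_proj S y = y"
  using assms by (intro orth_proj_unique) (auto simp: orthogonal_clauses)

text \<open>A subspace is recovered from its projection as the set of fixed points.\<close>

lemma orth_proj_eq_imp_eq:
  assumes "subspace S" "subspace T" "orth_proj S = orth_proj T"
  shows "S = T"
  using assms orth_proj_id orth_proj_in by (metis subsetI subset_antisym)

text \<open>Rescaling determines a linear map from its values near 0. This turns agreement of two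
  local formulas for the fit into equality of projections.\<close>

lemma linear_eq_if_eventually_eq:
  fixes P Q :: "'a::real_normed_vector \<Rightarrow> 'b::real_vector"
  assumes "linear P" "linear Q" and ev: "\<forall>\<^sub>F y' in nhds y. P (y' - y) = Q (y' - y)"
  shows "P = Q"
proof (rule ext)
  fix d :: 'a
  obtain e where e: "e > 0" "\<And>y'. dist y' y < e \<Longrightarrow> P (y' - y) = Q (y' - y)"
    using ev unfolding eventually_nhds_metric by auto
  \<comment> \<open>The \<open>+ 1\<close> keeps the denominator positive and the bound on
    \<open>t * norm d\<close> strict, also for \<open>d = 0\<close>.\<close>
  define t where "t = e / (norm d + 1)"
  have nd: "norm d + 1 > 0" by (intro add_nonneg_pos) auto
  then have t: "t > 0" using e by (simp add: t_def)
  then have "t * norm d < t * (norm d + 1)" by simp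
  also have "\<dots> = e" using nd by (simp add: t_def)
  finally have "P ((y + t *\<^sub>R d) - y) = Q ((y + t *\<^sub>R d) - y)"
    using t by (intro e(2)) (simp add: dist_norm)
  then have "t *\<^sub>R P d = t *\<^sub>R Q d" using assms by (simp add: linear_scale)
  then show "P d = Q d" using t by simp
qed

section \<open>Subgradient optimality conditions at parameter 1\<close>

definition kkt :: "real ^ 'p ^ 'n \<Rightarrow> real ^ 'n \<Rightarrow> real ^ 'p \<Rightarrow> bool" where
  "kkt X y \<beta> \<longleftrightarrow> (\<forall>j. \<bar>column j X \<bullet> (y - X *v \<beta>)\<bar> \<le> 1 \<and>
     (\<beta> $ j \<noteq> 0 \<longrightarrow> column j X \<bullet> (y - X *v \<beta>) = sgn (\<beta> $ j)))"

lemma inner_matrix_vector_mult: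
  fixes X :: "real ^ 'p ^ 'n"
  shows "u \<bullet> (X *v \<beta>) = (\<Sum>j\<in>UNIV. (column j X \<bullet> u) * \<beta> $ j)"
  unfolding matrix_mult_sum scalar_mult_eq_scaleR inner_sum_right inner_scaleR_right
  by (intro sum.cong refl) (simp add: inner_commute)

lemma lasso_objective_add:
  "lasso_objective X 1 y (\<beta> + d) = lasso_objective X 1 y \<beta> + (norm (X *v d))\<^sup>2 / 2
     - (y - X *v \<beta>) \<bullet> (X *v d) + ((\<Sum>j\<in>UNIV. \<bar>\<beta> $ j + d $ j\<bar>) - (\<Sum>j\<in>UNIV. \<bar>\<beta> $ j\<bar>))"
proof -
  have "y - X *v (\<beta> + d) = (y - X *v \<beta>) - X *v d" by (simp add: matrix_vector_right_distrib)
  then show ?thesis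
    unfolding lasso_objective_def
    by (simp add: power2_norm_eq_inner inner_diff inner_commute algebra_simps)
qed

text \<open>The correlations of the residual with the columns form a subgradient of the l1 norm at
  \<open>\<beta>\<close>, so the increase of the penalty outweighs the linear term; the quadratic
  term is nonnegative anyway.\<close>

lemma kkt_imp_lasso_solution:
  assumes k: "kkt X y \<beta>"
  shows "lasso_solution X 1 y \<beta>"
proof -
  let ?u = "y - X *v \<beta>"
  have "lasso_objective X 1 y \<beta> \<le> lasso_objective X 1 y \<beta>'" for \<beta>'
  proof -
    define d where "d = \<beta>' - \<beta>"
    have "?u \<bullet> (X *v d) = (\<Sum>j\<in>UNIV. (column j X \<bullet> ?u) * d $ j)" by (rule inner_matrix_vector_mult)
    also have "\<dots> \<le> (\<Sum>j\<in>UNIV. \<bar>\<beta> $ j + d $ j\<bar> - \<bar>\<beta> $ j\<bar>)"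
    proof (rule sum_mono)
      fix j
      let ?c = "column j X \<bullet> ?u"
      have c: "\<bar>?c\<bar> \<le> 1" "?c * \<beta> $ j = \<bar>\<beta> $ j\<bar>"
        using k by (auto simp: kkt_def) (metis abs_sgn mult.commute mult_zero_right abs_zero)
      have "?c * (\<beta> $ j + d $ j) \<le> \<bar>?c\<bar> * \<bar>\<beta> $ j + d $ j\<bar>" by (metis abs_ge_self abs_mult)
      also have "\<dots> \<le> \<bar>\<beta> $ j + d $ j\<bar>" using c(1) by (intro mult_left_le_one_le) auto
      finally show "?c * d $ j \<le> \<bar>\<beta> $ j + d $ j\<bar> - \<bar>\<beta> $ j\<bar>" using c(2) by (simp add: algebra_simps)
    qed
    finally have "?u \<bullet> (X *v d) \<le> (\<Sum>j\<in>UNIV. \<bar>\<beta> $ j + d $ j\<bar>) - (\<Sum>j\<in>UNIV. \<bar>\<beta> $ j\<bar>)"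
      by (simp add: sum_subtractf)
    moreover have "(norm (X *v d))\<^sup>2 / 2 \<ge> 0" by simp
    ultimately have "lasso_objective X 1 y \<beta> \<le> lasso_objective X 1 y (\<beta> + d)"
      unfolding lasso_objective_add by linarith
    then show ?thesis by (simp add: d_def)
  qed
  then show ?thesis by (simp add: lasso_solution_def is_arg_min_linorder)
qed

lemma nonpos_if_le_small:
  fixes x k :: real
  assumes "\<And>s. 0 < s \<Longrightarrow> s \<le> 1 \<Longrightarrow> x \<le> s * k"
  shows "x \<le> 0"
proof (rule tendsto_lowerbound)
  show "((\<lambda>s. s * k) \<longlongrightarrow> 0) (at_right 0)" by (auto intro!: tendsto_eq_intros)
  show "\<forall>\<^sub>F s in at_right 0. x \<le> s * k"
    using assms unfolding eventually_at_right_field by (intro exI[of _ 1]) auto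
qed auto

text \<open>First-order conditions in one coordinate. The perturbations \<open>s\<close> and
  \<open>- s\<close> bound \<open>c\<close>; shrinking \<open>b\<close> to
  \<open>(1 - s) * b\<close> gives \<open>\<bar>b\<bar> \<le> c * b\<close>, which together with
  that bound forces the sign.\<close>

lemma abs_perturbation_optimal:
  fixes a b c :: real
  assumes q: "\<And>t. 0 \<le> t\<^sup>2 * a - t * c + \<bar>b + t\<bar> - \<bar>b\<bar>"
  shows "\<bar>c\<bar> \<le> 1" and "b \<noteq> 0 \<Longrightarrow> c = sgn b"
proof -
  have "c - 1 \<le> 0"
  proof (rule nonpos_if_le_small)
    fix s :: real assume "0 < s" "s \<le> 1"
    then have "s * c \<le> s\<^sup>2 * a + s" using q[of s] by linarith
    then have "s * c \<le> s * (s * a + 1)" by (simp add: power2_eq_square algebra_simps)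
    with \<open>0 < s\<close> show "c - 1 \<le> s * a" by (simp add: mult_le_cancel_left)
  qed
  moreover have "- c - 1 \<le> 0"
  proof (rule nonpos_if_le_small)
    fix s :: real assume "0 < s" "s \<le> 1"
    then have "s * (- c) \<le> s\<^sup>2 * a + s" using q[of "- s"] by (simp; linarith)
    then have "s * (- c) \<le> s * (s * a + 1)" by (simp add: power2_eq_square algebra_simps)
    with \<open>0 < s\<close> have "- c \<le> s * a + 1" by (simp only: mult_le_cancel_left_pos)
    then show "- c - 1 \<le> s * a" by simp
  qed
  ultimately show c: "\<bar>c\<bar> \<le> 1" by simp
  assume b: "b \<noteq> 0"
  have "\<bar>b\<bar> - c * b \<le> 0"
  proof (rule nonpos_if_le_small)
    fix s :: real assume s: "0 < s" "s \<le> 1"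
    have "b + - (s * b) = (1 - s) * b" by (simp add: algebra_simps)
    then have "\<bar>b + - (s * b)\<bar> = (1 - s) * \<bar>b\<bar>"
      using s by (simp only: abs_mult)
    then have "s * (\<bar>b\<bar> - c * b) \<le> s * (s * (b\<^sup>2 * a))"
      using q[of "- (s * b)"] by (simp add: power2_eq_square algebra_simps)
    with s show "\<bar>b\<bar> - c * b \<le> s * (b\<^sup>2 * a)" by (simp only: mult_le_cancel_left_pos)
  qed
  then have *: "\<bar>b\<bar> \<le> c * b" by simp
  consider "b > 0" | "b < 0" using b by linarith
  then show "c = sgn b"
  proof cases
    case 1
    with * have "1 * b \<le> c * b" by simp
    with 1 have "1 \<le> c" by (simp only: mult_le_cancel_right_pos)
    with 1 c show ?thesis by simp
  next
    case 2
    with * have "(- 1) * b \<le> c * b" by simp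
    with 2 have "c \<le> - 1" by (simp only: mult_le_cancel_right_neg)
    with 2 c show ?thesis by simp
  qed
qed

lemma lasso_solution_imp_kkt:
  assumes sol: "lasso_solution X 1 y \<beta>"
  shows "kkt X y \<beta>"
  unfolding kkt_def
proof (intro allI)
  fix j
  let ?c = "column j X \<bullet> (y - X *v \<beta>)"
  \<comment> \<open>The penalty is separable, so perturbing one coordinate at a time already yields
    all conditions.\<close>
  have "0 \<le> t\<^sup>2 * ((norm (column j X))\<^sup>2 / 2) - t * ?c + \<bar>\<beta> $ j + t\<bar> - \<bar>\<beta> $ j\<bar>" for t
  proof -
    let ?d = "t *\<^sub>R axis j (1::real)"
    have Xd: "X *v ?d = t *\<^sub>R column j X"
      by (simp add: matrix_vector_mult_scaleR matrix_vector_mult_basis)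
    have "(\<Sum>k\<in>UNIV. \<bar>\<beta> $ k + ?d $ k\<bar> - \<bar>\<beta> $ k\<bar>) = (\<Sum>k\<in>UNIV. if k = j then \<bar>\<beta> $ j + t\<bar> - \<bar>\<beta> $ j\<bar> else 0)"
      by (intro sum.cong) (auto simp: axis_def)
    then have "(\<Sum>k\<in>UNIV. \<bar>\<beta> $ k + ?d $ k\<bar>) - (\<Sum>k\<in>UNIV. \<bar>\<beta> $ k\<bar>) = \<bar>\<beta> $ j + t\<bar> - \<bar>\<beta> $ j\<bar>"
      by (simp add: sum_subtractf)
    moreover have "lasso_objective X 1 y \<beta> \<le> lasso_objective X 1 y (\<beta> + ?d)"
      using sol by (simp add: lasso_solution_def is_arg_min_linorder)
    ultimately show ?thesis
      unfolding lasso_objective_add Xd by (simp add: power_mult_distrib inner_commute)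
  qed
  from abs_perturbation_optimal[OF this]
  show "\<bar>?c\<bar> \<le> 1 \<and> (\<beta> $ j \<noteq> 0 \<longrightarrow> ?c = sgn (\<beta> $ j))" by blast
qed

lemma lasso_solution_iff_kkt: "lasso_solution X 1 y \<beta> \<longleftrightarrow> kkt X y \<beta>"
  using kkt_imp_lasso_solution lasso_solution_imp_kkt by blast

text \<open>The objective dominates the norm, so a minimiser over the ball of radius
  \<open>R\<close>, the objective at 0, is a global one: outside this ball the objective is at least
  \<open>R\<close>.\<close>

lemma kkt_exists: "\<exists>\<beta>. kkt X y \<beta>"
proof -
  let ?f = "lasso_objective X 1 y"
  define R where "R = ?f 0"
  have lower: "norm \<beta> \<le> ?f \<beta>" for \<beta>
    using norm_le_l1_cart[of \<beta>] zero_le_power2[of "norm (y - X *v \<beta>)"]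
    unfolding lasso_objective_def by linarith
  have cont: "continuous_on (cball 0 R) ?f"
    unfolding lasso_objective_def
    by (intro continuous_intros linear_continuous_on matrix_vector_mul_bounded_linear)
  have R: "R \<ge> 0" using lower[of 0] by (simp add: R_def)
  then obtain \<beta> where \<beta>: "\<beta> \<in> cball 0 R" "\<And>\<gamma>. \<gamma> \<in> cball 0 R \<Longrightarrow> ?f \<beta> \<le> ?f \<gamma>"
    using continuous_attains_inf[OF compact_cball _ cont] by auto
  have "?f \<beta> \<le> ?f \<gamma>" for \<gamma>
  proof (cases "\<gamma> \<in> cball 0 R")
    case False
    then have "R \<le> ?f \<gamma>" using lower[of \<gamma>] by simp
    moreover have "?f \<beta> \<le> R" using \<beta>(2)[of 0] R by (simp add: R_def)
    ultimately show ?thesis by simp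
  qed (rule \<beta>)
  then have "lasso_solution X 1 y \<beta>" by (simp add: lasso_solution_def is_arg_min_linorder)
  then show ?thesis by (auto simp: lasso_solution_iff_kkt)
qed

text \<open>Monotonicity of the subdifferential of the l1 norm: the residual belonging to a solution
  pairs with its fit at least as strongly as any other optimal residual does. Hence
  \<open>?d\<close> pairs nonnegatively with the difference of the residuals, which is
  \<open>y\<^sub>1 - y\<^sub>2 - ?d\<close>. The case of equal data shows that the fit is
  unique.\<close>

lemma kkt_nonexpansive:
  assumes "kkt X y\<^sub>1 \<beta>\<^sub>1" "kkt X y\<^sub>2 \<beta>\<^sub>2"
  shows "norm (X *v \<beta>\<^sub>1 - X *v \<beta>\<^sub>2) \<le> norm (y\<^sub>1 - y\<^sub>2)"
proof -
  let ?u1 = "y\<^sub>1 - X *v \<beta>\<^sub>1" and ?u2 = "y\<^sub>2 - X *v \<beta>\<^sub>2" and ?d = "X *v \<beta>\<^sub>1 - X *v \<beta>\<^sub>2"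
  have mono: "(column j X \<bullet> (y - X *v \<beta>)) * \<beta> $ j \<ge> (column j X \<bullet> (y' - X *v \<beta>')) * \<beta> $ j"
    if "kkt X y \<beta>" "kkt X y' \<beta>'" for y \<beta> y' \<beta>' j
  proof (cases "\<beta> $ j = 0")
    case False
    let ?c = "column j X \<bullet> (y' - X *v \<beta>')"
    have "?c * \<beta> $ j \<le> \<bar>?c\<bar> * \<bar>\<beta> $ j\<bar>" by (metis abs_ge_self abs_mult)
    also have "\<dots> \<le> \<bar>\<beta> $ j\<bar>" using that by (intro mult_left_le_one_le) (auto simp: kkt_def)
    also have "\<dots> = (column j X \<bullet> (y - X *v \<beta>)) * \<beta> $ j"
      using that False by (auto simp: kkt_def abs_sgn mult.commute)
    finally show ?thesis .
  qed simp
  have m: "(y' - X *v \<beta>') \<bullet> (X *v \<beta>) \<le> (y - X *v \<beta>) \<bullet> (X *v \<beta>)"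
    if "kkt X y \<beta>" "kkt X y' \<beta>'" for y \<beta> y' \<beta>'
    unfolding inner_matrix_vector_mult by (intro sum_mono mono that)
  have "0 \<le> ?d \<bullet> (?u1 - ?u2)"
    using m[OF assms] m[OF assms(2,1)] by (simp add: inner_diff inner_commute)
  then have "(norm ?d)\<^sup>2 \<le> ?d \<bullet> (y\<^sub>1 - y\<^sub>2)"
    by (simp add: power2_norm_eq_inner inner_diff inner_commute)
  also have "\<dots> \<le> norm ?d * norm (y\<^sub>1 - y\<^sub>2)" by (rule norm_cauchy_schwarz)
  finally show ?thesis by (cases "norm ?d = 0") (auto simp: power2_eq_square mult_le_cancel_left)
qed

text \<open>The choice is harmless: solutions may differ, but \<open>lasso_fit_eq\<close> shows that
  they share the fit.\<close>

definition lasso_fit :: "real ^ 'p ^ 'n \<Rightarrow> real ^ 'n \<Rightarrow> real ^ 'n" where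
  "lasso_fit X y = X *v (SOME \<beta>. kkt X y \<beta>)"

lemma lasso_fit_eq:
  assumes "kkt X y \<beta>"
  shows "lasso_fit X y = X *v \<beta>"
  using kkt_nonexpansive[OF someI[of "kkt X y", OF assms] assms] by (simp add: lasso_fit_def)

lemma lasso_fit_lipschitz: "1-lipschitz_on UNIV (lasso_fit X)"
proof (rule lipschitz_onI)
  fix y z
  obtain \<beta> \<gamma> where "kkt X y \<beta>" "kkt X z \<gamma>" using kkt_exists by metis
  then show "dist (lasso_fit X y) (lasso_fit X z) \<le> 1 * dist y z"
    using kkt_nonexpansive[of X y \<beta> z \<gamma>] by (simp add: lasso_fit_eq dist_norm)
qed simp

section \<open>Regions of data admitting a solution with a given sign pattern\<close>

definition sign_region :: "real ^ 'p ^ 'n \<Rightarrow> ('p \<Rightarrow> real) \<Rightarrow> (real ^ 'n) set" where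
  "sign_region X s = {y. \<exists>\<beta>. kkt X y \<beta> \<and> (\<forall>j. sgn (\<beta> $ j) = s j)}"

abbreviation signs :: "('p \<Rightarrow> real) set" where
  "signs \<equiv> UNIV \<rightarrow>\<^sub>E {-1, 0, 1}"

lemma sgn_convex_combination:
  fixes x z :: real
  assumes "sgn x = sgn z" "a \<ge> 0" "b \<ge> 0" "a + b = 1"
  shows "sgn (a * x + b * z) = sgn z"
proof -
  consider "z = 0" | "z > 0" | "z < 0" by linarith
  then show ?thesis
  proof cases
    case 2
    then have "x > 0" using assms by (simp add: sgn_if split: if_splits)
    with 2 have "a * x + b * z > 0"
      using assms by (cases "a = 0") (auto intro: add_pos_nonneg)
    with 2 show ?thesis by simp
  next
    case 3
    then have "x < 0" using assms by (simp add: sgn_if split: if_splits)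
    with 3 have "a * x + b * z < 0"
      using assms by (cases "a = 0") (auto intro!: add_neg_nonpos mult_pos_neg mult_nonneg_nonpos)
    with 3 show ?thesis by simp
  qed (use assms in \<open>simp add: sgn_zero_iff\<close>)
qed

text \<open>For a fixed sign pattern the optimality conditions are affine equations and convex
  inequalities in data and coefficients jointly, so the same convex combination of two solutions is
  a solution.\<close>

lemma convex_sign_region: "convex (sign_region X s)"
proof (rule convexI)
  fix y z and a b :: real
  assume "y \<in> sign_region X s" "z \<in> sign_region X s" and ab: "a \<ge> 0" "b \<ge> 0" "a + b = 1"
  then obtain \<beta> \<gamma> where \<beta>: "kkt X y \<beta>" "\<And>j. sgn (\<beta> $ j) = s j" and \<gamma>: "kkt X z \<gamma>" "\<And>j. sgn (\<gamma> $ j) = s j"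
    by (auto simp: sign_region_def)
  define \<delta> where "\<delta> = a *\<^sub>R \<beta> + b *\<^sub>R \<gamma>"
  have sg: "sgn (\<delta> $ j) = s j" for j
    using sgn_convex_combination[of "\<beta> $ j" "\<gamma> $ j" a b] \<beta>(2) \<gamma>(2) ab by (simp add: \<delta>_def)
  have res: "column j X \<bullet> (a *\<^sub>R y + b *\<^sub>R z - X *v \<delta>)
      = a * (column j X \<bullet> (y - X *v \<beta>)) + b * (column j X \<bullet> (z - X *v \<gamma>))" for j
    by (simp add: \<delta>_def matrix_vector_right_distrib matrix_vector_mult_scaleR inner_diff_right inner_add_right algebra_simps)
  have "kkt X (a *\<^sub>R y + b *\<^sub>R z) \<delta>"
    unfolding kkt_def res
  proof (intro allI conjI impI)
    fix j
    have "\<bar>a * (column j X \<bullet> (y - X *v \<beta>)) + b * (column j X \<bullet> (z - X *v \<gamma>))\<bar> \<le> a * 1 + b * 1"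
      using \<beta>(1) \<gamma>(1) ab
      by (intro order_trans[OF abs_triangle_ineq] add_mono) (auto simp: abs_mult kkt_def intro!: mult_left_le)
    then show "\<bar>a * (column j X \<bullet> (y - X *v \<beta>)) + b * (column j X \<bullet> (z - X *v \<gamma>))\<bar> \<le> 1" using ab by simp
  next
    fix j assume "\<delta> $ j \<noteq> 0"
    then have "s j \<noteq> 0" using sg[of j] by (auto simp: sgn_zero_iff)
    then have "\<beta> $ j \<noteq> 0" "\<gamma> $ j \<noteq> 0" using \<beta>(2)[of j] \<gamma>(2)[of j] by auto
    then show "a * (column j X \<bullet> (y - X *v \<beta>)) + b * (column j X \<bullet> (z - X *v \<gamma>)) = sgn (\<delta> $ j)"
      using \<beta> \<gamma> ab sg unfolding kkt_def by (simp flip: distrib_right)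
  qed
  then show "a *\<^sub>R y + b *\<^sub>R z \<in> sign_region X s" using sg by (auto simp: sign_region_def)
qed

lemma matrix_vector_mult_in_col_space:
  assumes "\<And>j. j \<notin> A \<Longrightarrow> \<beta> $ j = 0"
  shows "X *v \<beta> \<in> col_space X A"
  unfolding matrix_mult_sum col_space_def scalar_mult_eq_scaleR
proof (intro span_sum)
  fix j
  show "\<beta> $ j *\<^sub>R column j X \<in> span ((\<lambda>j. column j X) ` A)"
  proof (cases "j \<in> A")
    case True
    then show ?thesis by (intro span_scale span_base) auto
  next
    case False
    then show ?thesis using assms[of j] by (simp add: span_zero)
  qed
qed

lemma subspace_col_space [simp]: "subspace (col_space X A)"
  by (simp add: col_space_def)

text \<open>On active columns both residuals have the same correlation \<open>s j\<close>, so their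
  difference is orthogonal to the active column space, whereas the difference of the fits lies in
  it.\<close>

lemma lasso_fit_affine_on_sign_region:
  assumes "y \<in> sign_region X s" "z \<in> sign_region X s"
  shows "lasso_fit X y - lasso_fit X z = orth_proj (col_space X {j. s j \<noteq> 0}) (y - z)"
proof -
  obtain \<beta> \<gamma> where \<beta>: "kkt X y \<beta>" "\<And>j. sgn (\<beta> $ j) = s j" and \<gamma>: "kkt X z \<gamma>" "\<And>j. sgn (\<gamma> $ j) = s j"
    using assms by (auto simp: sign_region_def)
  let ?S = "col_space X {j. s j \<noteq> 0}"
  have nz: "\<beta> $ j \<noteq> 0 \<longleftrightarrow> s j \<noteq> 0" "\<gamma> $ j \<noteq> 0 \<longleftrightarrow> s j \<noteq> 0" for j
    using \<beta>(2)[of j] \<gamma>(2)[of j] by (metis sgn_zero_iff)+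
  have "orth_proj ?S (y - z) = X *v \<beta> - X *v \<gamma>"
  proof (rule orth_proj_unique)
    show "X *v \<beta> - X *v \<gamma> \<in> ?S"
      using nz by (intro subspace_diff matrix_vector_mult_in_col_space subspace_col_space) auto
    fix w assume w: "w \<in> ?S"
    have "orthogonal ((y - X *v \<beta>) - (z - X *v \<gamma>)) w"
    proof (rule orthogonal_to_span)
      show "w \<in> span ((\<lambda>j. column j X) ` {j. s j \<noteq> 0})" using w by (simp add: col_space_def)
      fix v assume "v \<in> (\<lambda>j. column j X) ` {j. s j \<noteq> 0}"
      then obtain j where j: "s j \<noteq> 0" "v = column j X" by auto
      then have "v \<bullet> (y - X *v \<beta>) = s j" "v \<bullet> (z - X *v \<gamma>) = s j"
        using \<beta> \<gamma> nz unfolding kkt_def by auto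
      then show "orthogonal ((y - X *v \<beta>) - (z - X *v \<gamma>)) v"
        by (simp add: orthogonal_def inner_diff_left inner_commute[of _ v] inner_diff_right)
    qed
    then show "orthogonal (y - z - (X *v \<beta> - X *v \<gamma>)) w" by (simp add: algebra_simps)
  qed simp
  then show ?thesis using \<beta>(1) \<gamma>(1) by (simp add: lasso_fit_eq)
qed

text \<open>Regions may overlap, since solutions need not be unique. In this form
  \<open>lasso_spaces\<close> depends on \<open>y\<close> only through the set of regions containing
  it.\<close>

lemma lasso_spaces_eq: "lasso_spaces X 1 y = {col_space X {j. s j \<noteq> 0} | s. s \<in> signs \<and> y \<in> sign_region X s}"
proof -
  have "\<exists>s. col_space X (supp \<beta>) = col_space X {j. s j \<noteq> 0} \<and> s \<in> signs \<and> y \<in> sign_region X s"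
    if "kkt X y \<beta>" for \<beta>
  proof (intro exI[of _ "\<lambda>j. sgn (\<beta> $ j)"] conjI)
    show "(\<lambda>j. sgn (\<beta> $ j)) \<in> signs" by (simp add: PiE_iff sgn_if)
  qed (use that in \<open>auto simp: supp_def sgn_zero_iff sign_region_def\<close>)
  moreover have "\<exists>\<beta>. col_space X {j. s j \<noteq> 0} = col_space X (supp \<beta>) \<and> kkt X y \<beta>"
    if s: "y \<in> sign_region X s" for s
  proof -
    obtain \<beta> where \<beta>: "kkt X y \<beta>" "\<And>j. sgn (\<beta> $ j) = s j" using s by (auto simp: sign_region_def)
    have "{j. s j \<noteq> 0} = supp \<beta>" by (simp add: supp_def sgn_zero_iff flip: \<beta>(2))
    with \<beta>(1) show ?thesis by auto
  qed
  ultimately show ?thesis unfolding lasso_spaces_def lasso_solution_iff_kkt by blast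
qed

text \<open>
  Off the frontiers of the finitely many convex sign regions, the set of regions that contain a
  point is locally constant. All of these regions prescribe the same affine formula for the fit,
  hence the same column space.
\<close>

lemma lasso_locally_affine:
  fixes X :: "real ^ 'p ^ 'n"
  obtains N where "closed N" "negligible N"
    "\<And>y. y \<notin> N \<Longrightarrow> \<exists>P. linear P \<and>
       (\<forall>\<^sub>F y' in nhds y. lasso_fit X y' - lasso_fit X y = P (y' - y) \<and> lasso_ols X 1 y' = P y')"
proof (rule that)
  let ?N = "\<Union>s\<in>signs. frontier (sign_region X s)"
  have fin: "finite (signs :: ('p \<Rightarrow> real) set)" by (intro finite_PiE) auto
  show "closed ?N" by (intro closed_UN fin ballI frontier_closed)
  show "negligible ?N"
    using fin by (intro negligible_Union) (auto intro: negligible_convex_frontier convex_sign_region)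
  fix y assume y: "y \<notin> ?N"
  have "\<forall>\<^sub>F y' in nhds y. y' \<in> sign_region X s \<longleftrightarrow> y \<in> sign_region X s" if "s \<in> signs" for s
  proof (cases "y \<in> sign_region X s")
    case True
    then have "y \<in> interior (sign_region X s)" using y that closure_subset by (auto simp: frontier_def)
    then have "\<forall>\<^sub>F y' in nhds y. y' \<in> interior (sign_region X s)" by (intro eventually_nhds_in_open) auto
    then show ?thesis by (rule eventually_mono) (use True interior_subset in auto)
  next
    case False
    then have "y \<in> - closure (sign_region X s)" using y that interior_subset by (auto simp: frontier_def)
    then have "\<forall>\<^sub>F y' in nhds y. y' \<in> - closure (sign_region X s)" by (intro eventually_nhds_in_open) auto
    then show ?thesis by (rule eventually_mono) (use False closure_subset in auto)
  qed
  then have ev: "\<forall>\<^sub>F y' in nhds y. \<forall>s\<in>signs. y' \<in> sign_region X s \<longleftrightarrow> y \<in> sign_region X s"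
    using fin by (intro eventually_ball_finite) auto
  have fit: "\<forall>\<^sub>F y' in nhds y. lasso_fit X y' - lasso_fit X y = orth_proj (col_space X {j. s j \<noteq> 0}) (y' - y)"
    if "s \<in> signs" "y \<in> sign_region X s" for s
    using ev by (rule eventually_mono) (use that in \<open>auto intro!: lasso_fit_affine_on_sign_region\<close>)
  obtain \<beta> where "kkt X y \<beta>" using kkt_exists by blast
  then obtain S where S: "S \<in> lasso_spaces X 1 y" by (auto simp: lasso_spaces_def lasso_solution_iff_kkt)
  then obtain s where s: "S = col_space X {j. s j \<noteq> 0}" "s \<in> signs" "y \<in> sign_region X s"
    unfolding lasso_spaces_eq by blast
  have "T = S" if T: "T \<in> lasso_spaces X 1 y" for T
  proof -
    obtain r where r: "T = col_space X {j. r j \<noteq> 0}" "r \<in> signs" "y \<in> sign_region X r"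
      using T unfolding lasso_spaces_eq by blast
    have "orth_proj T = orth_proj S"
    proof (rule linear_eq_if_eventually_eq[OF linear_orth_proj linear_orth_proj])
      show "\<forall>\<^sub>F y' in nhds y. orth_proj T (y' - y) = orth_proj S (y' - y)"
        using fit[OF r(2,3)] fit[OF s(2,3)] unfolding r(1) s(1) by eventually_elim simp
    qed (simp_all add: r s)
    then show ?thesis using r s by (intro orth_proj_eq_imp_eq) auto
  qed
  with S have single: "lasso_spaces X 1 y = {S}" by blast
  have "\<forall>\<^sub>F y' in nhds y. lasso_fit X y' - lasso_fit X y = orth_proj S (y' - y) \<and> lasso_ols X 1 y' = orth_proj S y'"
    using ev fit[OF s(2,3), folded s(1)]
  proof eventually_elim
    case (elim y')
    \<comment> \<open>Both points lie in the same regions. The singleton property therefore holds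
      throughout the neighbourhood, and the default value 0 of \<open>lasso_ols\<close> does not
      occur there.\<close>
    have "lasso_spaces X 1 y' = lasso_spaces X 1 y"
      using elim(1) unfolding lasso_spaces_eq by blast
    then show ?case using elim(2) single by (simp add: lasso_ols_def is_singleton_def)
  qed
  then show "\<exists>P. linear P \<and>
       (\<forall>\<^sub>F y' in nhds y. lasso_fit X y' - lasso_fit X y = P (y' - y) \<and> lasso_ols X 1 y' = P y')"
    using s(1) by (intro exI[of _ "orth_proj S"]) (simp add: linear_orth_proj)
qed

section \<open>Homogeneity in the tuning parameter\<close>

lemma lasso_objective_scale:
  assumes "t > 0"
  shows "lasso_objective X t (t *\<^sub>R y) (t *\<^sub>R \<beta>) = t\<^sup>2 * lasso_objective X 1 y \<beta>"
proof -
  have "t *\<^sub>R y - X *v (t *\<^sub>R \<beta>) = t *\<^sub>R (y - X *v \<beta>)" by (simp add: matrix_vector_mult_scaleR algebra_simps)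
  then have n: "norm (t *\<^sub>R y - X *v (t *\<^sub>R \<beta>)) = t * norm (y - X *v \<beta>)"
    using assms by (simp only: norm_scaleR abs_of_pos)
  have "(\<Sum>j\<in>UNIV. \<bar>(t *\<^sub>R \<beta>) $ j\<bar>) = t * (\<Sum>j\<in>UNIV. \<bar>\<beta> $ j\<bar>)"
    using assms by (simp add: abs_mult sum_distrib_left)
  then show ?thesis unfolding lasso_objective_def n
    by (simp add: power_mult_distrib power2_eq_square algebra_simps)
qed

lemma lasso_solution_scale:
  assumes t: "t > 0"
  shows "lasso_solution X t (t *\<^sub>R y) (t *\<^sub>R \<beta>) \<longleftrightarrow> lasso_solution X 1 y \<beta>"
proof -
  have "(\<forall>\<gamma>. lasso_objective X t (t *\<^sub>R y) (t *\<^sub>R \<beta>) \<le> lasso_objective X t (t *\<^sub>R y) \<gamma>)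
      \<longleftrightarrow> (\<forall>\<gamma>. lasso_objective X t (t *\<^sub>R y) (t *\<^sub>R \<beta>) \<le> lasso_objective X t (t *\<^sub>R y) (t *\<^sub>R \<gamma>))"
    (is "?L \<longleftrightarrow> ?R")
  proof
    assume ?R
    show ?L
    proof
      fix \<gamma>
      show "lasso_objective X t (t *\<^sub>R y) (t *\<^sub>R \<beta>) \<le> lasso_objective X t (t *\<^sub>R y) \<gamma>"
        using \<open>?R\<close>[rule_format, of "inverse t *\<^sub>R \<gamma>"] t by simp
    qed
  qed simp
  then show ?thesis using t
    by (simp add: lasso_solution_def is_arg_min_linorder lasso_objective_scale)
qed

lemma lasso_spaces_scale:
  fixes X :: "real ^ 'p ^ 'n"
  assumes t: "t > 0"
  shows "lasso_spaces X t (t *\<^sub>R y) = lasso_spaces X 1 y"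
proof -
  have supp: "supp (t *\<^sub>R \<beta>) = supp \<beta>" for \<beta> :: "real ^ 'p" using t by (simp add: supp_def)
  have "{\<beta>. lasso_solution X t (t *\<^sub>R y) \<beta>} = (*\<^sub>R) t ` {\<beta>. lasso_solution X 1 y \<beta>}"
  proof (intro set_eqI iffI)
    fix \<beta> assume "\<beta> \<in> {\<beta>. lasso_solution X t (t *\<^sub>R y) \<beta>}"
    then have "lasso_solution X 1 y (inverse t *\<^sub>R \<beta>)"
      using lasso_solution_scale[OF t, of X y "inverse t *\<^sub>R \<beta>"] t by simp
    then show "\<beta> \<in> (*\<^sub>R) t ` {\<beta>. lasso_solution X 1 y \<beta>}"
      using t by (intro image_eqI[of _ _ "inverse t *\<^sub>R \<beta>"]) auto
  qed (auto simp: lasso_solution_scale[OF t])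
  then show ?thesis unfolding lasso_spaces_def setcompr_eq_image by (simp add: image_image supp)
qed

text \<open>The equation holds for every \<open>y\<close>, not only almost everywhere: the points
  without a unique active space scale along, and the default value 0 is fixed by scaling.\<close>

lemma lasso_ols_scale:
  assumes t: "t > 0"
  shows "lasso_ols X t y = t *\<^sub>R lasso_ols X 1 (y /\<^sub>R t)"
proof -
  have sp: "lasso_spaces X t y = lasso_spaces X 1 (y /\<^sub>R t)"
    using lasso_spaces_scale[OF t, of X "y /\<^sub>R t"] t by simp
  have "orth_proj S y = t *\<^sub>R orth_proj S (y /\<^sub>R t)" if "S \<in> lasso_spaces X t y" for S
  proof -
    have "linear (orth_proj S)" using that by (auto simp: lasso_spaces_def intro: linear_orth_proj)
    then show ?thesis using t by (simp add: linear_scale)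
  qed
  then show ?thesis unfolding lasso_ols_def sp by (auto simp: is_singleton_def)
qed

theorem theorem3p2:
  fixes M :: "'w measure"
    and Y :: "'w \<Rightarrow> real ^ 'n"
    and \<mu> :: "real ^ 'n"
    and \<sigma> :: real
    and X :: "real ^ 'p ^ 'n"
    and l :: real
  assumes "prob_space M"
    and "\<sigma> > 0"
    and "distributed M lborel Y (\<lambda>y. ennreal (gaussian_density \<mu> \<sigma> y))"
    and "l > 0"
  shows "df_exists M Y (lasso_ols X l) \<and>
         (\<forall>t>0. stein_df_exists M Y (lasso_ols X t)) \<and>
         (\<lambda>t. stein_df M Y (lasso_ols X t)) differentiable (at l) \<and>
         df M Y \<sigma> (lasso_ols X l) =
           stein_df M Y (lasso_ols X l) - l * deriv (\<lambda>t. stein_df M Y (lasso_ols X t)) l"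
proof -
  note M = assms(1) and s = assms(2) and Y = assms(3) and l = assms(4)
  let ?g = "\<lambda>t y. t *\<^sub>R lasso_fit X (y /\<^sub>R t)"
  define \<Phi> where "\<Phi> w = (\<integral>y. gaussian_density \<mu> \<sigma> y * ((y - \<mu>) \<bullet> w y) \<partial>lebesgue)" for w
  obtain N where N: "closed N" "negligible N"
    "\<And>y. y \<notin> N \<Longrightarrow> \<exists>P. linear P \<and>
       (\<forall>\<^sub>F y' in nhds y. lasso_fit X y' - lasso_fit X y = P (y' - y) \<and> lasso_ols X 1 y' = P y')"
    by (rule lasso_locally_affine[of X]) (rule that)
  interpret one: locally_linear_estimator "lasso_ols X 1" "lasso_fit X" N 1
    by unfold_locales (use N lasso_fit_lipschitz in auto)
  have ols: "lasso_ols X t = (\<lambda>y. t *\<^sub>R lasso_ols X 1 (y /\<^sub>R t))" if "t > 0" for t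
    using lasso_ols_scale[OF that] by (rule ext)
  have est: "locally_linear_estimator (lasso_ols X t) (?g t) ((*\<^sub>R) t ` N) 1" if "t > 0" for t
    unfolding ols[OF that] by (rule one.scaled[OF that])
  interpret l: locally_linear_estimator "lasso_ols X l" "?g l" "(*\<^sub>R) l ` N" 1
    by (rule est[OF l])
  define D where "D = \<Phi> (\<lambda>y. lasso_fit X (y /\<^sub>R l) - lasso_ols X 1 (y /\<^sub>R l))"
  have stein: "stein_df M Y (lasso_ols X t) = \<Phi> (?g t) / \<sigma>\<^sup>2" if "t > 0" for t
    unfolding \<Phi>_def by (rule locally_linear_estimator.stein_df_f[OF est[OF that] s Y])
  have "((\<lambda>t. \<Phi> (?g t) / \<sigma>\<^sup>2) has_real_derivative D / \<sigma>\<^sup>2) (at l)"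
    unfolding \<Phi>_def D_def by (intro DERIV_cdivide one.scaled_fit_integral_has_derivative s l)
  \<comment> \<open>The integral formula for \<open>stein_df\<close> is available for
    \<open>t > 0\<close> only, an open set containing \<open>l\<close>.\<close>
  then have deriv: "((\<lambda>t. stein_df M Y (lasso_ols X t)) has_real_derivative D / \<sigma>\<^sup>2) (at l)"
    by (rule has_field_derivative_transform_within_open[where S="{0<..}"]) (use l stein in auto)
  \<comment> \<open>Multiplying the slope by \<open>l\<close> restores both scaled maps, so
    \<open>l * D\<close> is the weighted integral of the fit minus the lasso-OLS estimator.\<close>
  have "l * D = (\<integral>y. gaussian_density \<mu> \<sigma> y * ((y - \<mu>) \<bullet> ?g l y)
      - gaussian_density \<mu> \<sigma> y * ((y - \<mu>) \<bullet> lasso_ols X l y) \<partial>lebesgue)"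
    unfolding D_def \<Phi>_def integral_mult_right_zero[symmetric] ols[OF l]
    by (intro Bochner_Integration.integral_cong refl) (simp add: inner_diff_right algebra_simps)
  also have "\<dots> = \<Phi> (?g l) - \<Phi> (lasso_ols X l)"
    unfolding \<Phi>_def
  proof (intro Bochner_Integration.integral_diff integrable_inner_gaussian(1)[OF s] l.measurable_g l.measurable_f)
    show "AE y in lebesgue. norm (?g l y) \<le> (norm (?g l \<mu>) + 1) * (1 + norm (y - \<mu>))"
      by (rule AE_I2[OF l.norm_g_le])
    show "AE y in lebesgue. norm (lasso_ols X l y) \<le> 1 * (1 + norm \<mu>) * (1 + norm (y - \<mu>))"
      using l.AE_not_in_N l.norm_f_le' by (rule eventually_mono)
  qed
  finally have "\<Phi> (lasso_ols X l) = \<Phi> (?g l) - l * D" by simp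
  then have "df M Y \<sigma> (lasso_ols X l) = stein_df M Y (lasso_ols X l) - l * (D / \<sigma>\<^sup>2)"
    using l.df_f[OF M s Y] unfolding stein[OF l] by (simp add: \<Phi>_def diff_divide_distrib)
  moreover have "deriv (\<lambda>t. stein_df M Y (lasso_ols X t)) l = D / \<sigma>\<^sup>2"
    using deriv by (rule DERIV_imp_deriv)
  moreover have "(\<lambda>t. stein_df M Y (lasso_ols X t)) differentiable (at l)"
    using deriv by (auto simp: real_differentiable_def)
  ultimately show ?thesis
    using l.df_exists_f[OF s Y] locally_linear_estimator.stein_df_exists_f[OF est s Y] by simp
qed

end
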